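(* Let $\widehat{U}^{norm}=U_{K,L,norm}/I$ where $I$ is the two-sided ideal generated by $K^n+L^n-\mathbf{1}$, $E^n$, $F^n$ (with the induced bialgebra structure). Then $$\widehat{R}=\sum_{0\le i,j,m\le n-1}A^{ij}_m(q)\,E^m(K+L)^i\otimes F^m(K+L)^j$$ is a universal $R$-matrix for $\widehat{U}^{norm}$: $\widehat{R}$ is invertible in $\widehat{U}^{norm}\otimes\widehat{U}^{norm}$, $\Delta^{cop}(b)=\widehat{R}\,\Delta(b)\,\widehat{R}^{-1}$ for all $b\in\widehat{U}^{norm}$, and $(\Delta\otimes\mathsf{id})(\widehat{R})=\widehat{R}_{13}\widehat{R}_{23}$, $(\mathsf{id}\otimes\Delta)(\widehat{R})=\widehat{R}_{13}\widehat{R}_{12}$.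
   Context: Let $n>1$ be an odd integer and $q$ a primitive $n$-th root of unity. $U_{K,L,norm}$ is the unital associative $\mathbb{C}$-algebra generated by $K,\overline{K},L,\overline{L},E,F$ subject to $K\overline{K}K=K$, $\overline{K}K\overline{K}=\overline{K}$, $K\overline{K}=\overline{K}K$, $L\overline{L}L=L$, $\overline{L}L\overline{L}=\overline{L}$, $L\overline{L}=\overline{L}L$, $K\overline{K}+L\overline{L}=\mathbf{1}$, $KE=q^2EK$, $LE=q^2EL$, $\overline{K}E=q^{-2}E\overline{K}$, $\overline{L}E=q^{-2}E\overline{L}$, $KF=q^{-2}FK$, $LF=q^{-2}FL$, $\overline{K}F=q^2F\overline{K}$, $\overline{L}F=q^2F\overline{L}$, $EF-FE=\frac{(K+L)-(\overline{K}+\overline{L})}{q-q^{-1}}$, with bialgebra structure given by the algebra homomorphisms $\Delta(K)=K\otimes K$, $\Delta(\overline{K})=\overline{K}\otimes\overline{K}$, $\Delta(L)=L\otimes L+L\otimes K+K\otimes L$, $\Delta(\overline{L})=\overline{L}\otimes\overline{L}+\overline{L}\otimes\overline{K}+\overline{K}\otimes\overline{L}$, $\Delta(E)=\mathbf{1}\otimes E+E\otimes(K+L)$, $\Delta(F)=F\otimes\mathbf{1}+(\overline{K}+\overline{L})\otimes F$, $\varepsilon(K)=\varepsilon(\overline{K})=1$, $\varepsilon(L)=\varepsilon(\overline{L})=\varepsilon(E)=\varepsilon(F)=0$. $\Delta^{cop}=\tau\circ\Delta$ with $\tau$ the flip. $(K+L)^0=\mathbf{1}$. The coefficients are $A^{ij}_m(q)=\frac{1}{n}\frac{(q-q^{-1})^m}{[m]!}q^{m(m-1)/2+2m(i-j)-2ij}$,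 where $[m]=\frac{q^m-q^{-m}}{q-q^{-1}}$, $[m]!=[1][2]\cdots[m]$. For $R=\sum_i s_i\otimes t_i$: $R_{12}=\sum s_i\otimes t_i\otimes\mathbf{1}$, $R_{13}=\sum s_i\otimes\mathbf{1}\otimes t_i$, $R_{23}=\sum\mathbf{1}\otimes s_i\otimes t_i$. *)

theory Defs
  imports Complex_Main
begin

text \<open>Terms of the free unital associative C-algebra on generators of type 'g.
  Sc c stands for the scalar c times the unit.\<close>
datatype 'g tm = Gen 'g | Sc complex | Add "'g tm" "'g tm" | Mul "'g tm" "'g tm"

instantiation tm :: (type) "{zero, one, plus, times, minus, power}"
begin
definition "0 = Sc 0"
definition "1 = Sc 1"
definition "a + b = Add a b"
definition "a * b = Mul a b"
definition "a - b = Add a (Mul (Sc (-1)) b)"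
instance ..
end

primrec subst :: "('g \<Rightarrow> 'h tm) \<Rightarrow> 'g tm \<Rightarrow> 'h tm" where
  "subst f (Gen g) = f g"
| "subst f (Sc c) = Sc c"
| "subst f (Add a b) = Add (subst f a) (subst f b)"
| "subst f (Mul a b) = Mul (subst f a) (subst f b)"

primrec tsum :: "'g tm list \<Rightarrow> 'g tm" where
  "tsum [] = Sc 0"
| "tsum (x # xs) = Add x (tsum xs)"

text \<open>Equality in the algebra presented by generators 'g and relations rels:
  the least congruence containing the unital associative C-algebra axioms and rels.
  Two terms are equal in the quotient algebra iff they are related.\<close>
inductive pres_eq :: "('g tm \<times> 'g tm) set \<Rightarrow> 'g tm \<Rightarrow> 'g tm \<Rightarrow> bool" for rels where
  rel: "(a, b) \<in> rels \<Longrightarrow> pres_eq rels a b"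
| refl: "pres_eq rels a a"
| sym: "pres_eq rels a b \<Longrightarrow> pres_eq rels b a"
| trans: "pres_eq rels a b \<Longrightarrow> pres_eq rels b c \<Longrightarrow> pres_eq rels a c"
| cong_add: "pres_eq rels a a' \<Longrightarrow> pres_eq rels b b' \<Longrightarrow> pres_eq rels (Add a b) (Add a' b')"
| cong_mul: "pres_eq rels a a' \<Longrightarrow> pres_eq rels b b' \<Longrightarrow> pres_eq rels (Mul a b) (Mul a' b')"
| add_assoc: "pres_eq rels (Add (Add a b) c) (Add a (Add b c))"
| add_comm: "pres_eq rels (Add a b) (Add b a)"
| add_zero: "pres_eq rels (Add a (Sc 0)) a"
| add_neg: "pres_eq rels (Add a (Mul (Sc (-1)) a)) (Sc 0)"
| mul_assoc: "pres_eq rels (Mul (Mul a b) c) (Mul a (Mul b c))"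
| mul_one_left: "pres_eq rels (Mul (Sc 1) a) a"
| mul_one_right: "pres_eq rels (Mul a (Sc 1)) a"
| distrib_left: "pres_eq rels (Mul a (Add b c)) (Add (Mul a b) (Mul a c))"
| distrib_right: "pres_eq rels (Mul (Add a b) c) (Add (Mul a c) (Mul b c))"
| sc_add: "pres_eq rels (Add (Sc x) (Sc y)) (Sc (x + y))"
| sc_mul: "pres_eq rels (Mul (Sc x) (Sc y)) (Sc (x * y))"
| sc_central: "pres_eq rels (Mul (Sc x) a) (Mul a (Sc x))"

datatype gen = GK | GKb | GL | GLb | GE | GF

definition primitive_root :: "nat \<Rightarrow> complex \<Rightarrow> bool" where
  "primitive_root n q \<longleftrightarrow> q ^ n = 1 \<and> (\<forall>k. 0 < k \<and> k < n \<longrightarrow> q ^ k \<noteq> 1)"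

definition Urels :: "nat \<Rightarrow> complex \<Rightarrow> (gen tm \<times> gen tm) set" where
  "Urels n q = (let K = Gen GK; Kb = Gen GKb; L = Gen GL; Lb = Gen GLb; E = Gen GE; F = Gen GF in
   { (K * Kb * K, K), (Kb * K * Kb, Kb), (K * Kb, Kb * K),
     (L * Lb * L, L), (Lb * L * Lb, Lb), (L * Lb, Lb * L),
     (K * Kb + L * Lb, 1),
     (K * E, Sc (q^2) * E * K), (L * E, Sc (q^2) * E * L),
     (Kb * E, Sc (inverse q ^ 2) * E * Kb), (Lb * E, Sc (inverse q ^ 2) * E * Lb),
     (K * F, Sc (inverse q ^ 2) * F * K), (L * F, Sc (inverse q ^ 2) * F * L),
     (Kb * F, Sc (q^2) * F * Kb), (Lb * F, Sc (q^2) * F * Lb),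
     (E * F - F * E, Sc (1 / (q - inverse q)) * ((K + L) - (Kb + Lb))),
     \<comment> \<open>generators of the ideal I\<close>
     (K ^ n + L ^ n - 1, 0), (E ^ n, 0), (F ^ n, 0) })"

text \<open>The k-fold tensor power of the quotient algebra, presented by k commuting copies
  (copy i uses generators (i, g), i < k); generators with index \<ge> k are set to zero.\<close>
definition Trels :: "nat \<Rightarrow> complex \<Rightarrow> nat \<Rightarrow> ((nat \<times> gen) tm \<times> (nat \<times> gen) tm) set" where
  "Trels n q k =
     {(map_tm (\<lambda>g. (i, g)) a, map_tm (\<lambda>g. (i, g)) b) | i a b. i < k \<and> (a, b) \<in> Urels n q}
   \<union> {(Gen (i, a) * Gen (j, b), Gen (j, b) * Gen (i, a)) | i j a b. i \<noteq> j}
   \<union> {(Gen (i, a), 0) | i a. k \<le> i}"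

abbreviation eq2 :: "nat \<Rightarrow> complex \<Rightarrow> (nat \<times> gen) tm \<Rightarrow> (nat \<times> gen) tm \<Rightarrow> bool" where
  "eq2 n q \<equiv> pres_eq (Trels n q 2)"
abbreviation eq3 :: "nat \<Rightarrow> complex \<Rightarrow> (nat \<times> gen) tm \<Rightarrow> (nat \<times> gen) tm \<Rightarrow> bool" where
  "eq3 n q \<equiv> pres_eq (Trels n q 3)"

text \<open>Images of generators under \<Delta>; a \<otimes> b is written copy0(a) * copy1(b).\<close>
fun delta_gen :: "gen \<Rightarrow> (nat \<times> gen) tm" where
  "delta_gen GK = Gen (0, GK) * Gen (1, GK)"
| "delta_gen GKb = Gen (0, GKb) * Gen (1, GKb)"
| "delta_gen GL = Gen (0, GL) * Gen (1, GL) + Gen (0, GL) * Gen (1, GK) + Gen (0, GK) * Gen (1, GL)"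
| "delta_gen GLb = Gen (0, GLb) * Gen (1, GLb) + Gen (0, GLb) * Gen (1, GKb) + Gen (0, GKb) * Gen (1, GLb)"
| "delta_gen GE = Gen (1, GE) + Gen (0, GE) * (Gen (1, GK) + Gen (1, GL))"
| "delta_gen GF = Gen (0, GF) + (Gen (0, GKb) + Gen (0, GLb)) * Gen (1, GF)"

definition Delta :: "gen tm \<Rightarrow> (nat \<times> gen) tm" where
  "Delta b = subst delta_gen b"

definition flip01 :: "nat \<times> gen \<Rightarrow> nat \<times> gen" where
  "flip01 x = (case x of (i, g) \<Rightarrow> (if i = 0 then 1 else if i = 1 then 0 else i, g))"

definition Delta_cop :: "gen tm \<Rightarrow> (nat \<times> gen) tm" where
  "Delta_cop b = subst (\<lambda>g. map_tm flip01 (delta_gen g)) b"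

definition Delta_id :: "(nat \<times> gen) tm \<Rightarrow> (nat \<times> gen) tm" where
  "Delta_id t = subst (\<lambda>(i, g). if i = 0 then delta_gen g else if i = 1 then Gen (2, g) else 0) t"

definition id_Delta :: "(nat \<times> gen) tm \<Rightarrow> (nat \<times> gen) tm" where
  "id_Delta t = subst (\<lambda>(i, g). if i = 0 then Gen (0, g)
                        else if i = 1 then map_tm (\<lambda>(j, h). (j + 1, h)) (delta_gen g) else 0) t"

definition legs :: "nat \<Rightarrow> nat \<Rightarrow> (nat \<times> gen) tm \<Rightarrow> (nat \<times> gen) tm" where
  "legs a b t = map_tm (\<lambda>(i, g). (if i = 0 then a else if i = 1 then b else i + 3, g)) t"

definition qint :: "complex \<Rightarrow> nat \<Rightarrow> complex" where
  "qint q m = (q ^ m - inverse q ^ m) / (q - inverse q)"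

definition qfact :: "complex \<Rightarrow> nat \<Rightarrow> complex" where
  "qfact q m = (\<Prod>k = 1..m. qint q k)"

definition Acoef :: "nat \<Rightarrow> complex \<Rightarrow> nat \<Rightarrow> nat \<Rightarrow> nat \<Rightarrow> complex" where
  "Acoef n q i j m = (1 / of_nat n) * ((q - inverse q) ^ m / qfact q m) *
     q powi (int (m * (m - 1) div 2) + 2 * int m * (int i - int j) - 2 * int i * int j)"

definition Rhat :: "nat \<Rightarrow> complex \<Rightarrow> (nat \<times> gen) tm" where
  "Rhat n q = tsum [ Sc (Acoef n q i j m)
        * (Gen (0, GE) ^ m * (Gen (0, GK) + Gen (0, GL)) ^ i)
        * (Gen (1, GF) ^ m * (Gen (1, GK) + Gen (1, GL)) ^ j)
      . i \<leftarrow> [0..<n], j \<leftarrow> [0..<n], m \<leftarrow> [0..<n]]"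

end

theory Submission
  imports Defs
begin

text \<open>Write \<open>k = K + L\<close>, \<open>c\<^sub>m = (q - q\<^sup>-\<^sup>1)\<^sup>m q\<^bsup>m(m-1)/2\<^esup> / [m]!\<close>. Moving the powers of \<open>k\<close> to the left factors the R-matrix as
  \<open>R = T exp\<^sub>q(E \<otimes> F)\<close> with \<open>T = 1/n \<Sum> q\<^bsup>-2ij\<^esup> k\<^sup>i \<otimes> k\<^sup>j\<close> and \<open>exp\<^sub>q x = \<Sum>\<^bsub>m<n\<^esub> c\<^sub>m x\<^sup>m\<close>.
  The factor \<open>T\<close> is bimultiplicative, and moving it past \<open>E\<close> or \<open>F\<close> in one leg creates \<open>k\<close> or \<open>k\<^sup>-\<^sup>1\<close> in the other;
  \<open>exp\<^sub>q(x + y) = exp\<^sub>q x exp\<^sub>q y\<close> when \<open>x y = q\<^sup>2 y x\<close>. Together these give both coproduct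
  identities. The intertwining property reduces to the commutator of \<open>E\<close> with \<open>F\<^sup>m\<close>, and \<open>R\<close> is invertible because
  \<open>T(k\<^sup>-\<^sup>1, k)\<close> inverts \<open>T\<close> and \<open>E \<otimes> F\<close> is nilpotent.\<close>

section \<open>Evaluation of terms in rings with central scalars\<close>

primrec ev :: "(complex \<Rightarrow> 'a::ring_1) \<Rightarrow> ('g \<Rightarrow> 'a) \<Rightarrow> 'g tm \<Rightarrow> 'a" where
  "ev s v (Gen g) = v g"
| "ev s v (Sc c) = s c"
| "ev s v (Add a b) = ev s v a + ev s v b"
| "ev s v (Mul a b) = ev s v a * ev s v b"

lemma ev_subst: "ev s v (subst f t) = ev s (\<lambda>g. ev s v (f g)) t"
  by (induction t) auto

lemma ev_map_tm: "ev s v (map_tm f t) = ev s (\<lambda>g. v (f g)) t"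
  by (induction t) auto

text \<open>A unital complex algebra, encoded by a ring homomorphism from the complex numbers into
  the centre, so that the carrier only has to be a ring type.\<close>

locale central_scalars =
  fixes \<sigma> :: "complex \<Rightarrow> 'a::ring_1"
  assumes scalar_add: "\<sigma> (x + y) = \<sigma> x + \<sigma> y"
    and scalar_mult: "\<sigma> (x * y) = \<sigma> x * \<sigma> y"
    and scalar_one: "\<sigma> 1 = 1"
    and scalar_central: "\<sigma> x * a = a * \<sigma> x"
begin

lemma scalar_zero: "\<sigma> 0 = 0"
  using scalar_add[of 0 0] by simp

lemma scalar_minus: "\<sigma> (- x) = - \<sigma> x"
  using scalar_add[of x "- x"] by (simp add: scalar_zero eq_neg_iff_add_eq_0 add.commute)

lemma scalar_diff: "\<sigma> (x - y) = \<sigma> x - \<sigma> y"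
  using scalar_add[of x "- y"] by (simp add: scalar_minus)

lemma scalar_sum: "\<sigma> (sum f A) = (\<Sum>x\<in>A. \<sigma> (f x))"
  by (induction A rule: infinite_finite_induct) (auto simp: scalar_zero scalar_add)

definition smult (infixr "\<odot>" 75) where "x \<odot> a = \<sigma> x * a"

lemma smult_simps:
  "a * (x \<odot> b) = x \<odot> (a * b)" "(x \<odot> a) * b = x \<odot> (a * b)" "x \<odot> (y \<odot> a) = (x * y) \<odot> a"
  by (simp_all add: smult_def mult.assoc scalar_mult) (metis mult.assoc scalar_central)

lemma smult_one [simp]: "1 \<odot> a = a"
  and smult_zero [simp]: "0 \<odot> a = 0" "x \<odot> 0 = 0"
  by (simp_all add: smult_def scalar_one scalar_zero)

lemma smult_add: "(x + y) \<odot> a = x \<odot> a + y \<odot> a"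
  and smult_add_right: "x \<odot> (a + b) = x \<odot> a + x \<odot> b"
  and smult_diff_right: "x \<odot> (a - b) = x \<odot> a - x \<odot> b"
  by (simp_all add: smult_def scalar_add scalar_diff algebra_simps)

lemma smult_sum: "sum f A \<odot> a = (\<Sum>x\<in>A. f x \<odot> a)"
  and smult_sum_right: "x \<odot> sum g A = (\<Sum>y\<in>A. x \<odot> g y)"
  by (simp_all add: smult_def scalar_sum sum_distrib_left sum_distrib_right)

lemma ev_simps [simp]:
  "ev \<sigma> v 0 = 0" "ev \<sigma> v 1 = 1" "ev \<sigma> v (a + b) = ev \<sigma> v a + ev \<sigma> v b"
  "ev \<sigma> v (a * b) = ev \<sigma> v a * ev \<sigma> v b" "ev \<sigma> v (a - b) = ev \<sigma> v a - ev \<sigma> v b"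
  by (simp_all add: zero_tm_def one_tm_def plus_tm_def times_tm_def minus_tm_def
      scalar_zero scalar_one scalar_minus)

lemma ev_power [simp]: "ev \<sigma> v (a ^ m) = ev \<sigma> v a ^ m"
  by (induction m) simp_all

lemma ev_tsum: "ev \<sigma> v (tsum ts) = (\<Sum>t\<leftarrow>ts. ev \<sigma> v t)"
  by (induction ts) (auto simp: scalar_zero)

text \<open>Soundness: every algebra axiom holds in a ring with central scalars, so evaluation
  factors through the presented algebra as soon as it respects the relations.\<close>

lemma pres_eq_imp_ev_eq:
  assumes "pres_eq rels a b" and "\<And>x y. (x, y) \<in> rels \<Longrightarrow> ev \<sigma> v x = ev \<sigma> v y"
  shows "ev \<sigma> v a = ev \<sigma> v b"
  using assms(1)
proof induction
  case (sc_central x a)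
  show ?case by (simp add: scalar_central)
qed (auto simp: assms(2) algebra_simps scalar_zero scalar_one scalar_minus scalar_add scalar_mult)

end

text \<open>The introduction rules of \<open>pres_eq\<close> hide \<open>refl\<close>, \<open>sym\<close>, \<open>trans\<close>, \<open>distrib_left\<close> and
  \<open>distrib_right\<close>, whence the qualified names \<open>HOL.refl\<close> and \<open>semiring_class.distrib_left\<close>.\<close>

lemma central_scalars_complex: "central_scalars (\<lambda>c::complex. c)"
  by standard auto

subsection \<open>A faithful model in a ring type\<close>

text \<open>A type cannot depend on the relations, so all presented algebras are put into one product
  ring, indexed by the sets of relations.\<close>

quotient_type 'g prod_alg =
  "('g tm \<times> 'g tm) set \<Rightarrow> 'g tm" / "\<lambda>f g. \<forall>r. pres_eq r (f r) (g r)"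
proof (rule equivpI)
  show "reflp (\<lambda>f g. \<forall>r. pres_eq r (f r) (g r))"
    by (auto intro: reflpI pres_eq.refl)
  show "symp (\<lambda>f g. \<forall>r. pres_eq r (f r) (g r))"
    by (auto intro: sympI pres_eq.sym)
  show "transp (\<lambda>f g. \<forall>r. pres_eq r (f r) (g r))"
    by (rule transpI) (blast intro: pres_eq.trans)
qed

instantiation prod_alg :: (type) ring_1
begin

lift_definition zero_prod_alg :: "'a prod_alg" is "\<lambda>_. Sc 0" .
lift_definition one_prod_alg :: "'a prod_alg" is "\<lambda>_. Sc 1" .
lift_definition plus_prod_alg :: "'a prod_alg \<Rightarrow> 'a prod_alg \<Rightarrow> 'a prod_alg"
  is "\<lambda>f g r. Add (f r) (g r)" by (blast intro: pres_eq.cong_add)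
lift_definition times_prod_alg :: "'a prod_alg \<Rightarrow> 'a prod_alg \<Rightarrow> 'a prod_alg"
  is "\<lambda>f g r. Mul (f r) (g r)" by (blast intro: pres_eq.cong_mul)
lift_definition uminus_prod_alg :: "'a prod_alg \<Rightarrow> 'a prod_alg"
  is "\<lambda>f r. Mul (Sc (-1)) (f r)" by (blast intro: pres_eq.cong_mul pres_eq.refl)
definition minus_prod_alg :: "'a prod_alg \<Rightarrow> 'a prod_alg \<Rightarrow> 'a prod_alg"
  where "minus_prod_alg a b = a + - b"

instance
proof
  fix a b c :: "'a prod_alg"
  show "a + b + c = a + (b + c)" by transfer (intro allI pres_eq.add_assoc)
  show comm: "a + b = b + a" for a b :: "'a prod_alg"
    by transfer (intro allI pres_eq.add_comm)
  have "a + 0 = a" by transfer (intro allI pres_eq.add_zero)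
  then show "0 + a = a" using comm[of 0 a] by simp
  have "a + - a = 0" by transfer (intro allI pres_eq.add_neg)
  then show "- a + a = 0" using comm[of a "- a"] by simp
  show "a - b = a + - b" by (rule minus_prod_alg_def)
  show "a * b * c = a * (b * c)" by transfer (intro allI pres_eq.mul_assoc)
  show "1 * a = a" by transfer (intro allI pres_eq.mul_one_left)
  show "a * 1 = a" by transfer (intro allI pres_eq.mul_one_right)
  show "(a + b) * c = a * c + b * c" by transfer (intro allI pres_eq.distrib_right)
  show "a * (b + c) = a * b + a * c" by transfer (intro allI pres_eq.distrib_left)
  \<comment> \<open>One nonzero component suffices for \<open>0 \<noteq> 1\<close>. For the empty
    set of relations, evaluation in the complex numbers separates the two scalars.\<close>
  have "\<not> pres_eq {} (Sc 0 :: 'a tm) (Sc 1)"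
    using central_scalars.pres_eq_imp_ev_eq[OF central_scalars_complex,
        of "{}" "Sc 0" "Sc 1" "\<lambda>_. 0"] by auto
  then show "(0 :: 'a prod_alg) \<noteq> 1" by transfer (rule notI, blast)
qed

end

lift_definition prod_scalar :: "complex \<Rightarrow> 'g prod_alg" is "\<lambda>c _. Sc c" .

lift_definition prod_gen :: "('g tm \<times> 'g tm) set \<Rightarrow> ('g \<Rightarrow> complex) \<Rightarrow> 'g \<Rightarrow> 'g prod_alg"
  is "\<lambda>r \<chi> g s. if s = r then Gen g else Sc (\<chi> g)" .

lift_definition prod_embed :: "('g tm \<times> 'g tm) set \<Rightarrow> ('g \<Rightarrow> complex) \<Rightarrow> 'g tm \<Rightarrow> 'g prod_alg"
  is "\<lambda>r \<chi> t s. if s = r then t else Sc (ev (\<lambda>c. c) \<chi> t)" .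

lemma central_scalars_prod: "central_scalars prod_scalar"
proof
  fix x y :: complex and a :: "'g prod_alg"
  show "(prod_scalar (x + y) :: 'g prod_alg) = prod_scalar x + prod_scalar y"
    by transfer (intro allI pres_eq.sym[OF pres_eq.sc_add])
  show "(prod_scalar (x * y) :: 'g prod_alg) = prod_scalar x * prod_scalar y"
    by transfer (intro allI pres_eq.sym[OF pres_eq.sc_mul])
  show "(prod_scalar 1 :: 'g prod_alg) = 1"
    by transfer (intro allI pres_eq.refl)
  show "prod_scalar x * a = a * prod_scalar x"
    by transfer (intro allI pres_eq.sc_central)
qed

lemma ev_prod_gen: "ev prod_scalar (prod_gen r \<chi>) t = prod_embed r \<chi> t"
proof (induction t)
  case (Gen g)
  show ?case by (simp, transfer) (auto intro: pres_eq.refl)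
next
  case (Sc c)
  show ?case by (simp, transfer) (auto intro: pres_eq.refl)
next
  case (Add a b)
  have "prod_embed r \<chi> (Add a b) = prod_embed r \<chi> a + prod_embed r \<chi> b"
    by transfer (auto intro: pres_eq.refl pres_eq.sym[OF pres_eq.sc_add])
  with Add show ?case by simp
next
  case (Mul a b)
  have "prod_embed r \<chi> (Mul a b) = prod_embed r \<chi> a * prod_embed r \<chi> b"
    by transfer (auto intro: pres_eq.refl pres_eq.sym[OF pres_eq.sc_mul])
  with Mul show ?case by simp
qed

text \<open>The character \<open>\<chi>\<close> fills the other factors of the product, which keeps the embedding unital.\<close>

lemma faithful_model:
  fixes r :: "('g tm \<times> 'g tm) set"
  assumes "\<And>a b. (a, b) \<in> r \<Longrightarrow> ev (\<lambda>c. c) \<chi> a = ev (\<lambda>c. c) \<chi> b"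
  obtains \<sigma> and v :: "'g \<Rightarrow> 'g prod_alg"
  where "central_scalars \<sigma>" and "\<And>a b. pres_eq r a b \<longleftrightarrow> ev \<sigma> v a = ev \<sigma> v b"
proof (rule that[OF central_scalars_prod])
  fix a b
  \<comment> \<open>Away from the component \<open>r\<close> both sides are the scalars given by
    \<open>\<chi>\<close>, which agree whenever \<open>a\<close> and \<open>b\<close> are related.
    Hence only the component \<open>r\<close> decides equality.\<close>
  have "ev (\<lambda>c. c) \<chi> a = ev (\<lambda>c. c) \<chi> b" if "pres_eq r a b"
    using central_scalars.pres_eq_imp_ev_eq[OF central_scalars_complex that assms] .
  moreover have "prod_embed r \<chi> a = prod_embed r \<chi> b \<longleftrightarrow>
      (\<forall>s. pres_eq s (if s = r then a else Sc (ev (\<lambda>c. c) \<chi> a)) (if s = r then b else Sc (ev (\<lambda>c. c) \<chi> b)))"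
    by transfer (rule HOL.refl)
  ultimately show "pres_eq r a b \<longleftrightarrow>
      ev prod_scalar (prod_gen r \<chi>) a = ev prod_scalar (prod_gen r \<chi>) b"
    unfolding ev_prod_gen by (auto intro: pres_eq.refl split: if_splits)
qed

subsection \<open>The Cartan part and the q-exponential\<close>

lemma commute_left: "b * a = a * b \<Longrightarrow> b * (a * x) = a * (b * x)" for a b x :: "'a::semigroup_mult"
  by (metis mult.assoc)

lemma commuting_power: "x * y = y * x \<Longrightarrow> x * y ^ m = y ^ m * x" for x y :: "'a::monoid_mult"
  by (metis power_commuting_commutes)

lemma power_mult_commuting:
  "x * y = y * x \<Longrightarrow> (x * y) ^ m = x ^ m * y ^ m" for x y :: "'a::monoid_mult"
proof (induction m)
  case (Suc m)
  have "y * x ^ m = x ^ m * y"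
    using Suc.prems by (metis commuting_power)
  then show ?case using Suc by (simp add: mult.assoc commute_left)
qed simp

lemma sum_cyclic_shift:
  fixes f :: "nat \<Rightarrow> 'a::ab_group_add"
  assumes "f n = f 0"
  shows "(\<Sum>j<n. f (Suc j)) = (\<Sum>j<n. f j)"
proof -
  have "(\<Sum>j<Suc n. f j) = f 0 + (\<Sum>j<n. f (Suc j))" by (rule sum.lessThan_Suc_shift)
  then show ?thesis using assms by simp
qed

lemma nilpotent_one_minus_inverse:
  fixes x :: "'a::ring_1"
  assumes "x ^ n = 0"
  shows "(1 - x) * (\<Sum>i<n. x ^ i) = 1" "(\<Sum>i<n. x ^ i) * (1 - x) = 1"
proof -
  have "(1 - x) * (\<Sum>i<m. x ^ i) = 1 - x ^ m" "(\<Sum>i<m. x ^ i) * (1 - x) = 1 - x ^ m" for m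
  proof -
    show *: "(1 - x) * (\<Sum>i<m. x ^ i) = 1 - x ^ m"
    proof (induction m)
      case (Suc m)
      then show ?case
        by (simp add: semiring_class.distrib_left) (simp add: left_diff_distrib)
    qed simp
    have "x * (\<Sum>i<m. x ^ i) = (\<Sum>i<m. x ^ i) * x"
      by (simp add: sum_distrib_left sum_distrib_right power_commutes)
    with * show "(\<Sum>i<m. x ^ i) * (1 - x) = 1 - x ^ m" by (simp add: algebra_simps)
  qed
  with assms show "(1 - x) * (\<Sum>i<n. x ^ i) = 1" "(\<Sum>i<n. x ^ i) * (1 - x) = 1" by auto
qed

section \<open>Powers of the root of unity, with \<open>p\<close> and \<open>u\<close> for the
  square of \<open>q\<close> and its inverse\<close>

locale root_scalars = central_scalars \<sigma> for \<sigma> :: "complex \<Rightarrow> 'a::ring_1" +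
  fixes n :: nat and q :: complex
  assumes n_odd: "odd n" and n_gt_1: "n > 1" and q_root: "primitive_root n q"
begin

definition p where "p \<equiv> q ^ 2"
definition u where "u \<equiv> inverse q ^ 2"

lemma q_nonzero: "q \<noteq> 0"
proof
  assume "q = 0"
  then show False using q_root n_gt_1 by (simp add: primitive_root_def power_0_left)
qed

lemma pu: "p * u = 1" "u * p = 1"
  using q_nonzero by (auto simp: p_def u_def simp flip: power_mult_distrib)

lemma pu_power: "p ^ m * u ^ m = 1" "u ^ m * p ^ m = 1"
  by (simp_all add: pu flip: power_mult_distrib)

lemma p_power_n: "p ^ n = 1"
  using q_root by (simp add: p_def primitive_root_def power2_eq_square power_mult_distrib)

lemma u_power_n: "u ^ n = 1"
  using pu_power(1)[of n] p_power_n by simp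

text \<open>The square of \<open>q\<close> is again a primitive root: oddness of \<open>n\<close>
  excludes \<open>2 * d = n\<close>, and otherwise \<open>2 * d\<close> or \<open>2 * d - n\<close>
  lies strictly between \<open>0\<close> and \<open>n\<close>.\<close>

lemma p_power_ne_1: assumes "0 < d" "d < n" shows "p ^ d \<noteq> 1"
proof
  assume "p ^ d = 1"
  then have *: "q ^ (2 * d) = 1" by (simp add: p_def power_mult)
  have "2 * d \<noteq> n" using n_odd by auto
  then consider "2 * d < n" | "n < 2 * d" by linarith
  then show False
  proof cases
    case 1 then show False using * assms q_root by (auto simp: primitive_root_def)
  next
    case 2
    then have "q ^ (2 * d) = q ^ n * q ^ (2 * d - n)" by (simp flip: power_add)
    then have "q ^ (2 * d - n) = 1" using * q_root by (simp add: primitive_root_def)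
    then show False using 2 assms q_root by (auto simp: primitive_root_def)
  qed
qed

lemma u_power_ne_1: assumes "0 < d" "d < n" shows "u ^ d \<noteq> 1"
  using pu_power(1)[of d] p_power_ne_1[OF assms] by auto

lemma p_ne_1: "p \<noteq> 1" and u_ne_1: "u \<noteq> 1"
  using p_power_ne_1[of 1] u_power_ne_1[of 1] n_gt_1 by auto

lemma q_diff_nonzero: "q - inverse q \<noteq> 0"
  using p_ne_1 q_nonzero by (auto simp: p_def power2_eq_square field_simps)

lemma smult_cancel: assumes "x \<noteq> 0" "x \<odot> a = x \<odot> b" shows "a = b"
proof -
  have "inverse x \<odot> (x \<odot> a) = inverse x \<odot> (x \<odot> b)" using assms by simp
  then show ?thesis using assms(1) by (simp add: smult_simps)
qed

lemma qcomm_power_left: "x * y = c \<odot> (y * x) \<Longrightarrow> x ^ m * y = c ^ m \<odot> (y * x ^ m)"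
proof (induction m)
  case (Suc m)
  have "x * (x ^ m * y) = c ^ m \<odot> (x * y * x ^ m)"
    by (simp add: Suc.IH[OF Suc.prems] mult.assoc smult_simps)
  also have "\<dots> = (c ^ Suc m) \<odot> (y * x ^ Suc m)"
    unfolding Suc.prems by (simp add: mult.assoc smult_simps mult.commute[of c])
  finally show ?case by (simp add: mult.assoc)
qed simp

lemma qcomm_power_right: "x * y = c \<odot> (y * x) \<Longrightarrow> x * y ^ m = c ^ m \<odot> (y ^ m * x)"
proof (induction m)
  case (Suc m)
  have "x * y ^ Suc m = x * y * y ^ m"
    by (simp add: mult.assoc)
  also have "\<dots> = c \<odot> (y * (x * y ^ m))"
    by (simp only: Suc.prems mult.assoc smult_simps)
  also have "\<dots> = c ^ Suc m \<odot> (y ^ Suc m * x)"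
    by (simp add: Suc.IH[OF Suc.prems] mult.assoc smult_simps)
  finally show ?case .
qed simp

lemma qcomm_powers:
  "x * y = c \<odot> (y * x) \<Longrightarrow> x ^ l * y ^ m = c ^ (l * m) \<odot> (y ^ m * x ^ l)"
  using qcomm_power_right[OF qcomm_power_left[of x y c l], of m] by (simp add: power_mult)

lemma qcomm_flip: assumes "x * y = p \<odot> (y * x)" shows "y * x = u \<odot> (x * y)"
  using assms pu by (simp add: smult_simps)

text \<open>Multiplication by \<open>z\<close> permutes the powers cyclically, so
  \<open>z - 1\<close> annihilates the sum.\<close>

lemma root_sum:
  assumes "z ^ n = 1" shows "(\<Sum>j<n. z ^ j) = (if z = 1 then of_nat n else (0::complex))"
proof -
  have "(\<Sum>j<n. z ^ Suc j) = (\<Sum>j<n. z ^ j)" using assms by (intro sum_cyclic_shift) simp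
  then have "z * (\<Sum>j<n. z ^ j) = (\<Sum>j<n. z ^ j)" by (simp add: sum_distrib_left)
  then have "(z - 1) * (\<Sum>j<n. z ^ j) = 0" by (simp add: algebra_simps)
  then show ?thesis by auto
qed

text \<open>For \<open>c ^ n = 1\<close> this is the spectral projection of \<open>c\<close> to the
  eigenvalue \<open>p ^ i\<close>, written as a discrete Fourier sum.\<close>

definition proj where "proj i c = (1 / of_nat n) \<odot> (\<Sum>j<n. u ^ (i * j) \<odot> c ^ j)"

lemma proj_commute: assumes "x * c = c * x" shows "x * proj i c = proj i c * x"
  unfolding proj_def
  by (simp add: smult_sum_right sum_distrib_left sum_distrib_right smult_simps mult.assoc
      commuting_power[OF assms])

text \<open>Multiplication by \<open>c\<close> shifts the index of the Fourier sum and costs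
  \<open>p ^ i\<close> in each term. The shift is cyclic because \<open>c ^ n = 1\<close> and
  \<open>u ^ n = 1\<close>.\<close>

lemma proj_mult: assumes "c ^ n = 1" shows "c * proj i c = p ^ i \<odot> proj i c"
proof -
  have un: "u ^ (i * n) = 1" using u_power_n by (metis mult.commute power_mult power_one)
  have "c * (\<Sum>j<n. u ^ (i * j) \<odot> c ^ j) = (\<Sum>j<n. p ^ i \<odot> (u ^ (i * Suc j) \<odot> c ^ Suc j))"
    unfolding sum_distrib_left
  proof (rule sum.cong[OF HOL.refl])
    fix j
    have "u ^ (i * j) = p ^ i * u ^ (i * Suc j)"
      by (simp add: power_add mult.assoc[symmetric] pu_power)
    then show "c * (u ^ (i * j) \<odot> c ^ j) = p ^ i \<odot> (u ^ (i * Suc j) \<odot> c ^ Suc j)"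
      by (simp only: smult_simps power_Suc)
  qed
  also have "\<dots> = p ^ i \<odot> (\<Sum>j<n. u ^ (i * Suc j) \<odot> c ^ Suc j)"
    by (simp only: smult_sum_right)
  also have "(\<Sum>j<n. u ^ (i * Suc j) \<odot> c ^ Suc j) = (\<Sum>j<n. u ^ (i * j) \<odot> c ^ j)"
    by (rule sum_cyclic_shift) (simp only: un assms mult_0_right power_0)
  finally show ?thesis unfolding proj_def
    by (simp only: smult_simps mult.commute)
qed

lemma proj_power: assumes "c ^ n = 1" shows "c ^ j * proj i c = p ^ (i * j) \<odot> proj i c"
proof (induction j)
  case (Suc j)
  have "c ^ Suc j * proj i c = c * (c ^ j * proj i c)" by (simp add: mult.assoc)
  also have "\<dots> = p ^ (i * j) \<odot> (c * proj i c)" by (simp only: Suc smult_simps)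
  also have "\<dots> = p ^ (i * Suc j) \<odot> proj i c"
    by (simp add: proj_mult[OF assms] smult_simps power_add mult.commute)
  finally show ?case .
qed simp

text \<open>By the eigenvalue property, \<open>proj l c\<close> acts on \<open>proj i c\<close> as
  the average of the powers of \<open>u ^ l * p ^ i\<close>, a root of unity that equals
  \<open>1\<close> only for \<open>l = i\<close>.\<close>

lemma proj_orthogonal:
  assumes "c ^ n = 1" "l < n" "i < n"
  shows "proj l c * proj i c = (if l = i then proj i c else 0)"
proof -
  let ?z = "u ^ l * p ^ i"
  have "proj l c * proj i c = (1 / of_nat n * (\<Sum>j<n. ?z ^ j)) \<odot> proj i c"
  proof -
    have "(\<Sum>j<n. u ^ (l * j) \<odot> c ^ j) * proj i c = (\<Sum>j<n. (?z ^ j) \<odot> proj i c)"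
      unfolding sum_distrib_right
      by (intro sum.cong HOL.refl)
        (simp only: mult.assoc proj_power[OF assms(1)] smult_simps power_mult power_mult_distrib)
    then show ?thesis
      by (simp only: proj_def[of l] smult_simps smult_sum[symmetric])
  qed
  moreover have "?z ^ n = 1"
    using u_power_n p_power_n
    by (simp add: power_mult_distrib flip: power_mult)
      (metis mult.commute power_mult power_one mult_1)
  moreover have "?z = 1 \<longleftrightarrow> l = i"
  proof (cases l i rule: linorder_cases)
    case less
    then have "?z = u ^ l * p ^ l * p ^ (i - l)"
      by (simp add: mult.assoc flip: power_add)
    then have "?z = p ^ (i - l)" using pu_power[of l] by simp
    then show ?thesis using less p_power_ne_1[of "i - l"] assms by auto
  next
    case greater
    then have "?z = u ^ (l - i) * (u ^ i * p ^ i)"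
      by (simp add: mult.assoc[symmetric] flip: power_add)
    then have "?z = u ^ (l - i)" using pu_power[of i] by simp
    then show ?thesis using greater u_power_ne_1[of "l - i"] assms by auto
  next
    case equal then show ?thesis using pu_power by simp
  qed
  ultimately show ?thesis
    using n_gt_1 by (simp add: root_sum )
qed

text \<open>The factor \<open>T\<close> with its inner sum collected into projections: on the
  \<open>p ^ i\<close>-eigenspace of \<open>k'\<close> it acts as \<open>k ^ i\<close>.\<close>

definition cartan where "cartan k k' = (\<Sum>i<n. k ^ i * proj i k')"

text \<open>The weight \<open>u ^ (i * j)\<close> of the double sum is symmetric in its indices.
  Rules about one argument thereby serve for the other.\<close>

lemma cartan_sym: assumes "k * k' = k' * k" shows "cartan k k' = cartan k' k"
proof -
  have comm: "k ^ i * k' ^ j = k' ^ j * k ^ i" for i j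
    by (metis assms power_commuting_commutes)
  have "cartan k k' = (\<Sum>i<n. \<Sum>j<n. (1 / of_nat n) \<odot> (u ^ (i * j) \<odot> (k ^ i * k' ^ j)))"
    by (simp add: cartan_def proj_def smult_sum_right sum_distrib_left smult_simps)
  also have "\<dots> = (\<Sum>j<n. \<Sum>i<n. (1 / of_nat n) \<odot> (u ^ (j * i) \<odot> (k' ^ j * k ^ i)))"
    by (subst sum.swap) (simp only: comm mult.commute[of _ "_::nat"])
  also have "\<dots> = cartan k' k"
    by (simp add: cartan_def proj_def smult_sum_right sum_distrib_left smult_simps)
  finally show ?thesis .
qed

lemma cartan_commute:
  assumes "x * k = k * x" "x * k' = k' * x" shows "x * cartan k k' = cartan k k' * x"
  unfolding cartan_def sum_distrib_left sum_distrib_right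
  by (intro sum.cong HOL.refl)
    (simp only: mult.assoc commute_left[OF commuting_power[OF assms(1)]] proj_commute[OF assms(2)])

text \<open>Moving \<open>x\<close> past \<open>k ^ i\<close> costs \<open>p ^ i\<close>, which is
  the eigenvalue of \<open>k'\<close> on \<open>proj i k'\<close>. The scalar therefore becomes a
  factor \<open>k'\<close>.\<close>

lemma cartan_raise:
  assumes "k * x = p \<odot> (x * k)" "x * k' = k' * x" "k * k' = k' * k" "k' ^ n = 1"
  shows "cartan k k' * x = x * k' * cartan k k'"
  unfolding cartan_def sum_distrib_left sum_distrib_right
proof (intro sum.cong HOL.refl)
  fix i
  have "k ^ i * proj i k' * x = k ^ i * x * proj i k'"
    by (simp add: mult.assoc proj_commute[OF assms(2)])
  also have "\<dots> = x * k ^ i * (p ^ i \<odot> proj i k')"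
    by (simp only: qcomm_power_left[OF assms(1)] mult.assoc smult_simps)
  also have "\<dots> = x * (k ^ i * k' * proj i k')"
    by (simp only: proj_mult[OF assms(4)] mult.assoc)
  also have "k ^ i * k' = k' * k ^ i"
    using assms(3) by (metis power_commuting_commutes)
  finally show "k ^ i * proj i k' * x = x * k' * (k ^ i * proj i k')"
    by (simp only: mult.assoc)
qed

text \<open>The scalar \<open>u ^ i\<close> from moving \<open>x\<close> cancels the eigenvalue
  \<open>p ^ i\<close> of \<open>k'\<close>. Keeping \<open>k'\<close> on the left-hand side avoids
  naming its inverse.\<close>

lemma cartan_lower:
  assumes "k * x = u \<odot> (x * k)" "x * k' = k' * x" "k' ^ n = 1"
  shows "cartan k k' * x * k' = x * cartan k k'"
  unfolding cartan_def sum_distrib_left sum_distrib_right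
proof (intro sum.cong HOL.refl)
  fix i
  have "k ^ i * proj i k' * x * k' = k ^ i * x * (k' * proj i k')"
    by (simp only: mult.assoc commute_left[OF proj_commute[OF assms(2), symmetric]]
        proj_commute[of k' k', OF HOL.refl])
  also have "\<dots> = (u ^ i * p ^ i) \<odot> (x * k ^ i * proj i k')"
    by (simp only: qcomm_power_left[OF assms(1)] proj_mult[OF assms(3)] mult.assoc
        smult_simps mult.commute[of "u ^ i"])
  finally show "k ^ i * proj i k' * x * k' = x * (k ^ i * proj i k')"
    by (simp add: pu_power mult.assoc)
qed

text \<open>Orthogonality of the projections leaves only the diagonal terms. This multiplicativity
  gives both the coproduct of the Cartan factor and its inverse.\<close>

lemma cartan_mult:
  assumes "a * b = b * a" "a * c = c * a" "b * c = c * b" "c ^ n = 1"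
  shows "cartan a c * cartan b c = cartan (a * b) c"
proof -
  have "cartan a c * cartan b c = (\<Sum>i<n. \<Sum>l<n. a ^ i * proj i c * (b ^ l * proj l c))"
    by (simp add: cartan_def sum_product)
  also have "\<dots> = (\<Sum>i<n. \<Sum>l<n. if l = i then a ^ i * b ^ i * proj i c else 0)"
  proof (intro sum.cong HOL.refl)
    fix i l assume "i \<in> {..<n}" "l \<in> {..<n}"
    have "b ^ l * proj i c = proj i c * b ^ l"
      using assms(3) by (metis proj_commute power_commuting_commutes)
    then have "a ^ i * proj i c * (b ^ l * proj l c) = a ^ i * b ^ l * (proj i c * proj l c)"
      by (metis mult.assoc)
    then show "a ^ i * proj i c * (b ^ l * proj l c) = (if l = i then a ^ i * b ^ i * proj i c else 0)"
      using \<open>i \<in> _\<close> \<open>l \<in> _\<close> by (simp add: proj_orthogonal[OF assms(4)])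
  qed
  also have "\<dots> = cartan (a * b) c"
    by (simp add: cartan_def power_mult_commuting[OF assms(1)])
  finally show ?thesis .
qed

lemma cartan_one_left: "cartan 1 c = 1"
proof -
  have "proj i 1 = (if i = 0 then 1 else 0)" if "i < n" for i
  proof -
    have "(u ^ i) ^ n = 1" using u_power_n by (metis mult.commute power_mult power_one)
    moreover have "proj i 1 = (1 / of_nat n * (\<Sum>j<n. (u ^ i) ^ j)) \<odot> 1"
      by (simp only: proj_def power_one power_mult smult_sum smult_simps(3)[symmetric])
    ultimately show ?thesis
      using that u_power_ne_1[of i] n_gt_1 by (auto simp: root_sum )
  qed
  \<comment> \<open>The value is computed with \<open>1\<close> as second argument, where the
    projections select \<open>i = 0\<close>, and then transferred by symmetry.\<close>
  then have "cartan c 1 = (\<Sum>i<n. if i = 0 then c ^ i else 0)"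
    unfolding cartan_def by (intro sum.cong) auto
  also have "\<dots> = 1" using n_gt_1 by simp
  finally show ?thesis by (simp add: cartan_sym[of 1])
qed

section \<open>The truncated q-exponential\<close>

definition coef where "coef m = (q - inverse q) ^ m / qfact q m * q ^ (m * (m - 1) div 2)"

lemma coef_0: "coef 0 = 1"
  by (simp add: coef_def qfact_def)

text \<open>The recursion of the coefficients with its denominator cleared;
  \<open>qint q (Suc m)\<close> is \<open>1 - u ^ Suc m\<close> up to nonzero factors, and does not
  vanish below \<open>n\<close>.\<close>

lemma coef_Suc:
  assumes "Suc m < n"
  shows "coef (Suc m) * (1 - u ^ Suc m) = (q - inverse q) ^ 2 * inverse q * coef m"
proof -
  have "Suc m * m = m * (m - 1) + 2 * m" by (cases m) auto
  then have "Suc m * (Suc m - 1) div 2 = m * (m - 1) div 2 + m" by simp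
  then have "coef (Suc m) = (q - inverse q) ^ Suc m / (qfact q m * qint q (Suc m)) * (q ^ (m * (m - 1) div 2) * q ^ m)"
    by (simp only: coef_def qfact_def power_add prod.nat_ivl_Suc')
       (simp add: mult.commute)
  also have "\<dots> = coef m * ((q - inverse q) * q ^ m / qint q (Suc m))"
    by (simp add: coef_def)
  finally have *: "coef (Suc m) = coef m * ((q - inverse q) * q ^ m / qint q (Suc m))" .
  have iq: "inverse q ^ Suc m = q ^ Suc m * u ^ Suc m"
  proof -
    have "inverse q = q * u" using q_nonzero by (simp add: u_def power2_eq_square)
    then show ?thesis by (metis power_mult_distrib)
  qed
  have **: "qint q (Suc m) = q ^ Suc m * (1 - u ^ Suc m) / (q - inverse q)"
    unfolding qint_def iq by (simp add: algebra_simps)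
  have "1 - u ^ Suc m \<noteq> 0" using u_power_ne_1[of "Suc m"] assms by auto
  then show ?thesis unfolding * **
    using q_nonzero q_diff_nonzero by (simp add: power2_eq_square) (simp add: divide_inverse ac_simps)
qed

definition qexp where "qexp x = (\<Sum>m<n. coef m \<odot> x ^ m)"

lemma qexp_intertwine:
  assumes "a * t = t * b" shows "qexp a * t = t * qexp b"
proof -
  have "a ^ m * t = t * b ^ m" for m
  proof (induction m)
    case (Suc m)
    then show ?case by (metis assms mult.assoc power_Suc)
  qed simp
  then show ?thesis
    by (simp add: qexp_def smult_sum_right sum_distrib_left sum_distrib_right smult_simps mult.assoc)
qed

text \<open>The constant coefficient is \<open>1\<close>, so \<open>1 - qexp x\<close> is
  \<open>x\<close> times an element commuting with \<open>x\<close>. It is thus nilpotent, and the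
  geometric series inverts \<open>qexp x\<close>.\<close>

lemma qexp_inverse:
  assumes "x ^ n = 0"
  shows "qexp x * (\<Sum>i<n. (1 - qexp x) ^ i) = 1" "(\<Sum>i<n. (1 - qexp x) ^ i) * qexp x = 1"
proof -
  obtain n' where n': "n = Suc n'" using n_gt_1 by (cases n) auto
  define z where "z = - (\<Sum>m<n'. coef (Suc m) \<odot> x ^ m)"
  have "qexp x = 1 + (\<Sum>m<n'. coef (Suc m) \<odot> x ^ Suc m)"
  proof -
    have "qexp x = (\<Sum>m<Suc n'. coef m \<odot> x ^ m)" by (simp only: qexp_def flip: n')
    then show ?thesis by (simp only: sum.lessThan_Suc_shift) (simp add: coef_0)
  qed
  then have "1 - qexp x = x * z"
    by (simp add: z_def smult_sum_right sum_distrib_left smult_simps)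
  moreover have "x * z = z * x"
    by (simp add: z_def smult_sum_right sum_distrib_left sum_distrib_right smult_simps mult.assoc power_commutes)
  ultimately have "(1 - qexp x) ^ n = 0"
    by (simp add: power_mult_commuting assms)
  from nilpotent_one_minus_inverse[OF this] show
    "qexp x * (\<Sum>i<n. (1 - qexp x) ^ i) = 1" "(\<Sum>i<n. (1 - qexp x) ^ i) * qexp x = 1"
    by simp_all
qed

text \<open>The q-binomial theorem in divided-power form. The induction step is proved after
  multiplication by the nonzero scalar \<open>1 - u ^ Suc m\<close>, where the recursion of the
  coefficients has no denominators.\<close>

lemma coef_power_add:
  assumes "x * y = p \<odot> (y * x)" "m < n"
  shows "coef m \<odot> (x + y) ^ m = (\<Sum>r\<le>m. (coef r * coef (m - r)) \<odot> (x ^ r * y ^ (m - r)))"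
  using assms(2)
proof (induction m)
  case 0
  then show ?case by (simp add: coef_0)
next
  case (Suc m)
  let ?g = "(q - inverse q) ^ 2 * inverse q"
  let ?M = "Suc m"
  \<comment> \<open>\<open>g\<close> collects the contributions of multiplying by \<open>x\<close>
    on the right, which must pass the powers of \<open>y\<close>, and \<open>h\<close> those of
    multiplying by \<open>y\<close>.\<close>
  define g where "g r = (coef r * (1 - u ^ r) * coef (?M - r) * u ^ (?M - r)) \<odot> (x ^ r * y ^ (?M - r))" for r
  define h where "h r = (coef r * coef (?M - r) * (1 - u ^ (?M - r))) \<odot> (x ^ r * y ^ (?M - r))" for r
  have yx: "y ^ s * x = u ^ s \<odot> (x * y ^ s)" for s
    by (rule qcomm_power_left[OF qcomm_flip[OF assms(1)]])
  have "(1 - u ^ ?M) \<odot> (coef ?M \<odot> (x + y) ^ ?M) = ?g \<odot> (coef m \<odot> (x + y) ^ m * (x + y))"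
    using coef_Suc[OF Suc.prems]
    by (simp only: smult_simps mult.assoc mult.commute[of _ "coef _"] power_Suc2)
  also have "coef m \<odot> (x + y) ^ m = (\<Sum>r\<le>m. (coef r * coef (m - r)) \<odot> (x ^ r * y ^ (m - r)))"
    using Suc by simp
  also have "?g \<odot> (\<dots> * (x + y)) = (\<Sum>r\<le>m. g (Suc r) + h r)"
    unfolding smult_sum_right sum_distrib_right
  proof (rule sum.cong[OF HOL.refl])
    fix r assume "r \<in> {..m}"
    then have r: "r \<le> m" by simp
    have "?g \<odot> ((coef r * coef (m - r)) \<odot> (x ^ r * y ^ (m - r)) * x) = g (Suc r)"
    proof -
      have "g (Suc r) = ((?g * coef r) * coef (m - r) * u ^ (m - r)) \<odot> (x ^ Suc r * y ^ (m - r))"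
        unfolding g_def using coef_Suc[of r] r Suc.prems by simp
      moreover have "x ^ r * y ^ (m - r) * x = u ^ (m - r) \<odot> (x ^ Suc r * y ^ (m - r))"
        by (simp only: mult.assoc yx smult_simps power_Suc2)
      ultimately show ?thesis by (simp only: mult.assoc smult_simps)
    qed
    moreover have "?g \<odot> ((coef r * coef (m - r)) \<odot> (x ^ r * y ^ (m - r)) * y) = h r"
    proof -
      have "?M - r = Suc (m - r)" using r by simp
      then have "h r = (coef r * (?g * coef (m - r))) \<odot> (x ^ r * y ^ Suc (m - r))"
        unfolding h_def using coef_Suc[of "m - r"] r Suc.prems by (simp add: mult.assoc)
      then show ?thesis
        by (simp only: mult.assoc smult_simps power_Suc2 mult.left_commute)
    qed
    ultimately show "?g \<odot> ((coef r * coef (m - r)) \<odot> (x ^ r * y ^ (m - r)) * (x + y)) = g (Suc r) + h r"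
      by (simp add: semiring_class.distrib_left smult_add_right)
  qed
  \<comment> \<open>The boundary terms \<open>g 0\<close> and \<open>h (Suc m)\<close> vanish, since
    each contains \<open>1 - u ^ 0\<close>.\<close>
  also have "\<dots> = (\<Sum>r\<le>?M. g r + h r)"
  proof -
    have "(\<Sum>r\<le>?M. g r) = (\<Sum>r\<le>m. g (Suc r))"
      by (subst sum.atMost_Suc_shift) (simp add: g_def)
    moreover have "(\<Sum>r\<le>?M. h r) = (\<Sum>r\<le>m. h r)"
      by (simp add: h_def)
    ultimately show ?thesis by (simp only: sum.distrib)
  qed
  also have "\<dots> = (1 - u ^ ?M) \<odot> (\<Sum>r\<le>?M. (coef r * coef (?M - r)) \<odot> (x ^ r * y ^ (?M - r)))"
    unfolding smult_sum_right
  proof (rule sum.cong[OF HOL.refl])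
    fix r assume "r \<in> {..?M}"
    then have "u ^ ?M = u ^ r * u ^ (?M - r)" by (simp flip: power_add)
    \<comment> \<open>The q-Pascal rule
      \<open>(1 - u ^ r) * u ^ s + (1 - u ^ s) = 1 - u ^ (r + s)\<close>.\<close>
    then have "coef r * (1 - u ^ r) * coef (?M - r) * u ^ (?M - r) + coef r * coef (?M - r) * (1 - u ^ (?M - r))
        = (1 - u ^ ?M) * (coef r * coef (?M - r))"
      by (simp add: algebra_simps)
    then show "g r + h r = (1 - u ^ ?M) \<odot> ((coef r * coef (?M - r)) \<odot> (x ^ r * y ^ (?M - r)))"
      unfolding g_def h_def by (simp only: smult_simps flip: smult_add)
  qed
  finally have eq: "(1 - u ^ ?M) \<odot> (coef ?M \<odot> (x + y) ^ ?M) = \<dots>" .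
  have "1 - u ^ ?M \<noteq> 0" using u_power_ne_1[of ?M] Suc.prems by simp
  from smult_cancel[OF this eq] show ?case .
qed

text \<open>The vanishing hypothesis cuts the square of index pairs down to the triangle
  \<open>r + s < n\<close>, whose diagonals are given by the q-binomial theorem.\<close>

lemma qexp_add:
  assumes "x * y = p \<odot> (y * x)" "\<And>r s. n \<le> r + s \<Longrightarrow> x ^ r * y ^ s = 0"
  shows "qexp (x + y) = qexp x * qexp y"
proof -
  let ?f = "\<lambda>r s. (coef r * coef s) \<odot> (x ^ r * y ^ s)"
  have "qexp x * qexp y = (\<Sum>r<n. \<Sum>s<n. ?f r s)"
    by (simp add: qexp_def sum_product mult.assoc smult_simps mult.commute)
  also have "\<dots> = (\<Sum>(r, s)\<in>{..<n} \<times> {..<n}. ?f r s)"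
    by (simp add: sum.cartesian_product)
  also have "\<dots> = (\<Sum>(r, s)\<in>{(r, s). r + s < n}. ?f r s)"
    by (intro sum.mono_neutral_right) (auto, metis assms(2) not_le smult_zero(2))
  also have "\<dots> = (\<Sum>m<n. \<Sum>r\<le>m. ?f r (m - r))"
    by (rule sum.triangle_reindex)
  also have "\<dots> = qexp (x + y)"
    unfolding qexp_def by (intro sum.cong HOL.refl) (simp add: coef_power_add[OF assms(1)])
  finally show ?thesis by simp
qed

end

subsection \<open>The R-matrix as a product\<close>

context root_scalars
begin

lemma qcomm_left: "x * y = c \<odot> (y * x) \<Longrightarrow> x * (y * z) = c \<odot> (y * (x * z))"
  by (metis mult.assoc smult_simps(2))

section \<open>Commutators with the q-exponential\<close>

definition \<delta> where "\<delta> = 1 / (q - inverse q)"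

text \<open>The commutator with \<open>e\<close> is a derivation; moving \<open>k\<close> and
  \<open>l\<close> past the powers of \<open>f\<close> produces the two geometric sums.\<close>

lemma commutator_power:
  assumes "e * f - f * e = \<delta> \<odot> (k - l)" "k * f = u \<odot> (f * k)" "l * f = p \<odot> (f * l)"
  shows "e * f ^ Suc m - f ^ Suc m * e
    = f ^ m * ((\<delta> * (\<Sum>t<Suc m. u ^ t)) \<odot> k - (\<delta> * (\<Sum>t<Suc m. p ^ t)) \<odot> l)"
proof (induction m)
  case 0
  show ?case using assms(1) by (simp add: smult_diff_right)
next
  case (Suc m)
  let ?a = "\<Sum>t<Suc m. u ^ t" and ?b = "\<Sum>t<Suc m. p ^ t"
  have a: "(\<Sum>t<Suc (Suc m). u ^ t) = 1 + ?a * u"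
    by (subst sum.lessThan_Suc_shift) (simp only: sum_distrib_right power_Suc2 power_0)
  have b: "(\<Sum>t<Suc (Suc m). p ^ t) = 1 + ?b * p"
    by (subst sum.lessThan_Suc_shift) (simp only: sum_distrib_right power_Suc2 power_0)
  have "e * f ^ Suc (Suc m) - f ^ Suc (Suc m) * e
      = (e * f ^ Suc m - f ^ Suc m * e) * f + f ^ Suc m * (e * f - f * e)"
    by (simp only: power_Suc2[of f "Suc m"] left_diff_distrib right_diff_distrib mult.assoc) simp
  also have "\<dots> = f ^ m * (((\<delta> * ?a) \<odot> k - (\<delta> * ?b) \<odot> l) * f) + f ^ Suc m * (\<delta> \<odot> (k - l))"
    by (simp only: Suc.IH assms(1) mult.assoc)
  also have "((\<delta> * ?a) \<odot> k - (\<delta> * ?b) \<odot> l) * f = f * ((\<delta> * ?a * u) \<odot> k - (\<delta> * ?b * p) \<odot> l)"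
    by (simp only: left_diff_distrib right_diff_distrib smult_simps assms(2,3))
  also have "f ^ m * (f * ((\<delta> * ?a * u) \<odot> k - (\<delta> * ?b * p) \<odot> l)) + f ^ Suc m * (\<delta> \<odot> (k - l))
      = f ^ Suc m * ((\<delta> * ?a * u) \<odot> k - (\<delta> * ?b * p) \<odot> l + \<delta> \<odot> (k - l))"
    by (simp only: power_Suc2[of f m] ring_distribs mult.assoc)
  also have "(\<delta> * ?a * u) \<odot> k - (\<delta> * ?b * p) \<odot> l + \<delta> \<odot> (k - l)
      = (\<delta> * (1 + ?a * u)) \<odot> k - (\<delta> * (1 + ?b * p)) \<odot> l"
    by (simp only: ring_distribs smult_add smult_diff_right mult.assoc mult_1_right) simp
  finally show ?case by (simp only: a b)
qed

text \<open>The normalisation of \<open>coef\<close> cancels the geometric sum of the commutator, so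
  that commuting with a q-exponential reproduces a q-exponential.\<close>

lemma coef_Suc_sum_u:
  assumes "Suc m < n" shows "coef (Suc m) * (\<delta> * (\<Sum>t<Suc m. u ^ t)) = coef m"
proof -
  have "1 - u ^ Suc m = (1 - u) * (\<Sum>t<Suc m. u ^ t)"
    by (rule one_diff_power_eq)
  then have *: "coef (Suc m) * (\<Sum>t<Suc m. u ^ t) * (1 - u) = (q - inverse q) ^ 2 * inverse q * coef m"
    using coef_Suc[OF assms] by (simp only: mult.assoc) (simp only: mult.commute)
  have "\<delta> * ((q - inverse q) ^ 2 * inverse q) = (q - inverse q) * inverse q"
    using q_diff_nonzero by (simp add: \<delta>_def power2_eq_square)
  also have "\<dots> = 1 - u"
    using q_nonzero by (simp add: u_def power2_eq_square left_diff_distrib)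
  finally have "coef (Suc m) * (\<delta> * (\<Sum>t<Suc m. u ^ t)) * (1 - u) = coef m * (1 - u)"
    using * by (metis mult.assoc mult.commute)
  then show ?thesis using u_ne_1 by simp
qed

lemma sum_p_eq: "(\<Sum>t<Suc m. p ^ t) = p ^ m * (\<Sum>t<Suc m. u ^ t)"
proof (induction m)
  case (Suc m)
  have "(\<Sum>t<Suc (Suc m). u ^ t) = 1 + u * (\<Sum>t<Suc m. u ^ t)"
    by (subst sum.lessThan_Suc_shift) (simp add: sum_distrib_left ring_distribs)
  moreover have "p ^ Suc m * (u * z) = p ^ m * z" for z
    using pu(1) by simp
  ultimately have "p ^ Suc m * (\<Sum>t<Suc (Suc m). u ^ t) = p ^ Suc m + p ^ m * (\<Sum>t<Suc m. u ^ t)"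
    by (simp only: ring_distribs mult_1_right)
  then show ?case using Suc by simp
qed simp

lemma coef_Suc_sum_p:
  assumes "Suc m < n" shows "coef (Suc m) * (\<delta> * (\<Sum>t<Suc m. p ^ t)) = coef m * p ^ m"
  unfolding sum_p_eq using coef_Suc_sum_u[OF assms] by (metis mult.assoc mult.commute)

text \<open>The commutator of \<open>e\<close> with each term lowers the degree in \<open>f\<close>
  by one, and the coefficients match those of the q-exponential again. The element \<open>x\<close>
  comes from the other leg; the statement serves for both \<open>E\<close> and
  \<open>F\<close>.\<close>

lemma qexp_coproduct:
  assumes "e * f - f * e = \<delta> \<odot> (k - l)" "k * f = u \<odot> (f * k)" "l * f = p \<odot> (f * l)"
    and "x ^ n = 0" "e * x = x * e" "f * x = x * f" "k * x = x * k" "l * x = x * l"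
  shows "qexp (x * f) * (e + x * k) = (x * l + e) * qexp (x * f)"
proof -
  obtain N where N: "n = Suc N" using n_gt_1 by (cases n) auto
  let ?g = "\<lambda>m. coef m \<odot> (x ^ Suc m * (f ^ m * (k - p ^ m \<odot> l)))"
  have powers: "(x * f) ^ m = x ^ m * f ^ m" for m
    using assms(6) by (intro power_mult_commuting) simp
  have ex: "e * (x ^ m * z) = x ^ m * (e * z)" for m z
    by (intro commute_left commuting_power assms)
  have fx: "f ^ m * (x * z) = x * (f ^ m * z)" for m z
    by (intro commute_left) (metis assms(6) power_commuting_commutes)
  have lx: "l * (x ^ m * z) = x ^ m * (l * z)" for m z
    by (intro commute_left commuting_power assms)
  have "e * qexp (x * f) - qexp (x * f) * e
      = (\<Sum>m<n. coef m \<odot> (x ^ m * (e * f ^ m - f ^ m * e)))"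
    by (simp only: qexp_def powers sum_distrib_left sum_distrib_right smult_simps ex mult.assoc
        right_diff_distrib smult_diff_right sum_subtractf)
  also have "\<dots> = (\<Sum>m<N. coef (Suc m) \<odot> (x ^ Suc m * (e * f ^ Suc m - f ^ Suc m * e)))"
    by (simp only: N sum.lessThan_Suc_shift) simp
  also have "\<dots> = (\<Sum>m<N. ?g m)"
  proof (rule sum.cong[OF HOL.refl])
    fix m assume "m \<in> {..<N}"
    then have "Suc m < n" using N by simp
    then show "coef (Suc m) \<odot> (x ^ Suc m * (e * f ^ Suc m - f ^ Suc m * e)) = ?g m"
      by (simp only: commutator_power[OF assms(1-3)] right_diff_distrib smult_diff_right
          smult_simps coef_Suc_sum_u coef_Suc_sum_p)
  qed
  \<comment> \<open>The added top term contains \<open>x ^ n = 0\<close>, so the full range of the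
    q-exponential is restored.\<close>
  also have "\<dots> = (\<Sum>m<n. ?g m)"
    using assms(4) by (simp add: N)
  also have "\<dots> = qexp (x * f) * (x * k) - x * l * qexp (x * f)"
  proof -
    have "x ^ m * (f ^ m * (x * k)) - x * (l * (x ^ m * f ^ m)) = x ^ Suc m * (f ^ m * (k - p ^ m \<odot> l))" for m
      by (simp only: fx lx qcomm_power_right[OF assms(3)])
        (simp add: right_diff_distrib mult.assoc power_commutes commute_left[of "x ^ m" x] smult_simps)
    then show ?thesis
      by (simp add: qexp_def powers sum_distrib_left sum_distrib_right smult_simps mult.assoc
        flip: sum_subtractf smult_diff_right)
  qed
  finally show ?thesis by (simp add: algebra_simps)
qed

text \<open>Tensor legs are modelled by commuting elements of one ring. Coproducts and leg
  embeddings then become changes of the four arguments.\<close>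

definition rmatrix where
  "rmatrix e k f k' = (\<Sum>i<n. \<Sum>j<n. \<Sum>m<n. Acoef n q i j m \<odot> ((e ^ m * k ^ i) * (f ^ m * k' ^ j)))"

text \<open>Splits the coefficient into the weight of \<open>T\<close>, the coefficient of the
  q-exponential, and the scalar that reordering the generators produces.\<close>

lemma Acoef_eq:
  "Acoef n q i j m = 1 / of_nat n * u ^ (i * j) * coef m * (u ^ (j * m) * p ^ (i * m))"
proof -
  let ?N = "m * (m - 1) div 2"
  have "int ?N + 2 * int m * (int i - int j) - 2 * int i * int j
      = int (?N + 2 * (i * m)) - int (2 * (j * m + i * j))"
    by (simp add: algebra_simps)
  then have "q powi (int ?N + 2 * int m * (int i - int j) - 2 * int i * int j)
      = q ^ (?N + 2 * (i * m)) / q ^ (2 * (j * m + i * j))"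
  proof -
    have "q powi (int a - int b) = q ^ a / q ^ b" for a b
      using q_nonzero by (simp add: power_int_diff)
    then show ?thesis by (simp only: \<open>_ = int _ - int _\<close>)
  qed
  also have "\<dots> = q ^ ?N * p ^ (i * m) * (u ^ (j * m) * u ^ (i * j))"
    by (simp only: p_def u_def power_add power_mult divide_inverse power_inverse
        inverse_mult_distrib mult.assoc)
  finally show ?thesis
    by (simp add: Acoef_def coef_def)
qed

text \<open>Moving \<open>k ^ i\<close> past \<open>e ^ m\<close> and \<open>k' ^ j\<close> past
  \<open>f ^ m\<close> yields exactly the last factor in \<open>Acoef_eq\<close>.\<close>

lemma rmatrix_eq:
  assumes "k * e = p \<odot> (e * k)" "k' * f = u \<odot> (f * k')" "e * f = f * e" "k' * e = e * k'"
    and "k * f = f * k"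
  shows "rmatrix e k f k' = cartan k k' * qexp (e * f)"
proof -
  have "cartan k k' * qexp (e * f) = (\<Sum>i<n. \<Sum>j<n. \<Sum>m<n.
      (1 / of_nat n * u ^ (i * j) * coef m) \<odot> (k ^ i * k' ^ j * (e ^ m * f ^ m)))"
  proof -
    have "cartan k k' = (\<Sum>i<n. \<Sum>j<n. (1 / of_nat n * u ^ (i * j)) \<odot> (k ^ i * k' ^ j))"
      by (simp add: cartan_def proj_def smult_sum_right sum_distrib_left smult_simps)
    moreover have "qexp (e * f) = (\<Sum>m<n. coef m \<odot> (e ^ m * f ^ m))"
      by (simp only: qexp_def power_mult_commuting[OF assms(3)])
    ultimately show ?thesis
      by (simp only: sum_distrib_right) (simp only: sum_distrib_left smult_simps mult.commute)
  qed
  also have "\<dots> = rmatrix e k f k'"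
    unfolding rmatrix_def
  proof (intro sum.cong HOL.refl)
    fix i j m
    have 1: "k' ^ j * e ^ m = e ^ m * k' ^ j"
      by (metis assms(4) power_commuting_commutes)
    have 2: "k ^ i * f ^ m = f ^ m * k ^ i"
      by (metis assms(5) power_commuting_commutes)
    have "k ^ i * k' ^ j * (e ^ m * f ^ m) = (k ^ i * e ^ m) * (k' ^ j * f ^ m)"
      by (simp only: mult.assoc commute_left[OF 1])
    also have "\<dots> = (u ^ (j * m) * p ^ (i * m)) \<odot> ((e ^ m * k ^ i) * (f ^ m * k' ^ j))"
      by (simp only: qcomm_powers[OF assms(1)] qcomm_powers[OF assms(2)] smult_simps)
    finally show "(1 / of_nat n * u ^ (i * j) * coef m) \<odot> (k ^ i * k' ^ j * (e ^ m * f ^ m))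
        = Acoef n q i j m \<odot> ((e ^ m * k ^ i) * (f ^ m * k' ^ j))"
      by (simp only: Acoef_eq smult_simps)
  qed
  finally show ?thesis ..
qed

text \<open>The relations of the small quantum group of sl2. In the application \<open>k\<close> is
  \<open>K + L\<close> and \<open>l\<close> is the sum of the generators \<open>GKb\<close> and
  \<open>GLb\<close>.\<close>

definition leg where
  "leg e f k l \<longleftrightarrow> k * l = 1 \<and> l * k = 1 \<and> k ^ n = 1 \<and> e ^ n = 0 \<and> f ^ n = 0
    \<and> k * e = p \<odot> (e * k) \<and> k * f = u \<odot> (f * k)
    \<and> l * e = u \<odot> (e * l) \<and> l * f = p \<odot> (f * l)
    \<and> e * f - f * e = \<delta> \<odot> (k - l)"

end

definition commuting :: "'a::times set \<Rightarrow> 'a set \<Rightarrow> bool" where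
  "commuting A B \<longleftrightarrow> (\<forall>a\<in>A. \<forall>b\<in>B. b * a = a * b)"

context root_scalars
begin

section \<open>Two commuting legs: intertwining and invertibility\<close>

context
  fixes e0 f0 k0 l0 e1 f1 k1 l1 :: 'a
  assumes leg0: "leg e0 f0 k0 l0" and leg1: "leg e1 f1 k1 l1"
    and comm01: "commuting {e0, f0, k0, l0} {e1, f1, k1, l1}"
begin

lemma leg_inverse [simp]:
  "k0 * l0 = 1" "l0 * k0 = 1" "k0 * (l0 * x) = x" "l0 * (k0 * x) = x"
  "k1 * l1 = 1" "l1 * k1 = 1" "k1 * (l1 * x) = x" "l1 * (k1 * x) = x"
  using leg0 leg1 by (auto simp: leg_def simp flip: mult.assoc)

lemma leg_qcomm:
  "k0 * e0 = p \<odot> (e0 * k0)" "k0 * f0 = u \<odot> (f0 * k0)" "l0 * e0 = u \<odot> (e0 * l0)" "l0 * f0 = p \<odot> (f0 * l0)"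
  "k1 * e1 = p \<odot> (e1 * k1)" "k1 * f1 = u \<odot> (f1 * k1)" "l1 * e1 = u \<odot> (e1 * l1)" "l1 * f1 = p \<odot> (f1 * l1)"
  using leg0 leg1 by (auto simp: leg_def)

lemma leg_torsion:
  "k0 ^ n = 1" "k1 ^ n = 1" "e0 ^ n = 0" "f0 ^ n = 0" "e1 ^ n = 0" "f1 ^ n = 0"
  using leg0 leg1 by (auto simp: leg_def)

lemma comm01_rules:
  "e1 * e0 = e0 * e1" "e1 * f0 = f0 * e1" "e1 * k0 = k0 * e1" "e1 * l0 = l0 * e1"
  "f1 * e0 = e0 * f1" "f1 * f0 = f0 * f1" "f1 * k0 = k0 * f1" "f1 * l0 = l0 * f1"
  "k1 * e0 = e0 * k1" "k1 * f0 = f0 * k1" "k1 * k0 = k0 * k1" "k1 * l0 = l0 * k1"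
  "l1 * e0 = e0 * l1" "l1 * f0 = f0 * l1" "l1 * k0 = k0 * l1" "l1 * l0 = l0 * l1"
  using comm01 by (simp_all add: commuting_def)

lemma rmatrix_legs: "rmatrix e0 k0 f1 k1 = cartan k0 k1 * qexp (e0 * f1)"
  by (rule rmatrix_eq) (simp_all add: leg_qcomm comm01_rules)

lemma cartan_legs_sym: "cartan k0 k1 = cartan k1 k0"
  by (rule cartan_sym) (simp add: comm01_rules)

text \<open>The q-exponential carries the coproduct of \<open>E\<close> to the intermediate element
  \<open>e0 * l1 + e1\<close>, and the Cartan factor carries that to the flipped coproduct.\<close>

lemma rmatrix_E: "rmatrix e0 k0 f1 k1 * (e1 + e0 * k1) = (e0 + e1 * k0) * rmatrix e0 k0 f1 k1"
proof -
  have *: "qexp (e0 * f1) * (e1 + e0 * k1) = (e0 * l1 + e1) * qexp (e0 * f1)"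
    using leg1 by (intro qexp_coproduct leg_torsion) (auto simp: leg_def comm01_rules)
  have "cartan k0 k1 * (e0 * l1) = e0 * k1 * (cartan k0 k1 * l1)"
    using cartan_raise[of k0 e0 k1] by (simp add: leg_qcomm leg_torsion comm01_rules mult.assoc[symmetric])
  also have "cartan k0 k1 * l1 = l1 * cartan k0 k1"
    by (rule cartan_commute[symmetric]) (simp_all add: comm01_rules)
  finally have 1: "cartan k0 k1 * (e0 * l1) = e0 * cartan k0 k1"
    by (simp add: mult.assoc)
  have 2: "cartan k0 k1 * e1 = e1 * k0 * cartan k0 k1"
    unfolding cartan_legs_sym
    by (rule cartan_raise) (simp_all add: leg_qcomm leg_torsion comm01_rules)
  have "rmatrix e0 k0 f1 k1 * (e1 + e0 * k1) = cartan k0 k1 * (e0 * l1 + e1) * qexp (e0 * f1)"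
    by (simp only: rmatrix_legs mult.assoc *)
  also have "cartan k0 k1 * (e0 * l1 + e1) = (e0 + e1 * k0) * cartan k0 k1"
    by (simp only: ring_distribs 1 2)
  finally show ?thesis by (simp only: rmatrix_legs mult.assoc)
qed

lemma rmatrix_F: "rmatrix e0 k0 f1 k1 * (f0 + l0 * f1) = (f1 + l1 * f0) * rmatrix e0 k0 f1 k1"
proof -
  \<comment> \<open>With \<open>f0\<close>, \<open>e0\<close>, \<open>l0\<close>, \<open>k0\<close>
    in the roles of \<open>e\<close>, \<open>f\<close>, \<open>k\<close>, \<open>l\<close> the same
    commutator relation holds, so \<open>qexp_coproduct\<close> applies with
    \<open>x = f1\<close>.\<close>
  have "f0 * e0 - e0 * f0 = \<delta> \<odot> (l0 - k0)"
    using leg0 by (simp add: leg_def smult_diff_right) (metis minus_diff_eq)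
  then have "qexp (f1 * e0) * (f0 + f1 * l0) = (f1 * k0 + f0) * qexp (f1 * e0)"
    by (intro qexp_coproduct leg_torsion) (auto simp: leg_qcomm comm01_rules)
  then have *: "qexp (e0 * f1) * (f0 + l0 * f1) = (f1 * k0 + f0) * qexp (e0 * f1)"
    by (simp add: comm01_rules)
  have 1: "cartan k0 k1 * (f1 * k0) = f1 * cartan k0 k1"
    unfolding cartan_legs_sym mult.assoc[symmetric]
    by (rule cartan_lower) (simp_all add: leg_qcomm leg_torsion comm01_rules)
  have "cartan k0 k1 * f0 * k1 = f0 * cartan k0 k1"
    by (rule cartan_lower) (simp_all add: leg_qcomm leg_torsion comm01_rules)
  then have "cartan k0 k1 * f0 * k1 * l1 = f0 * (cartan k0 k1 * l1)"
    by (simp only: mult.assoc)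
  also have "cartan k0 k1 * l1 = l1 * cartan k0 k1"
    by (rule cartan_commute[symmetric]) (simp_all add: comm01_rules)
  finally have 2: "cartan k0 k1 * f0 = l1 * f0 * cartan k0 k1"
    by (simp add: mult.assoc comm01_rules commute_left[OF comm01_rules(14)])
  have "rmatrix e0 k0 f1 k1 * (f0 + l0 * f1) = cartan k0 k1 * (f1 * k0 + f0) * qexp (e0 * f1)"
    by (simp only: rmatrix_legs mult.assoc *)
  also have "cartan k0 k1 * (f1 * k0 + f0) = (f1 + l1 * f0) * cartan k0 k1"
    by (simp only: ring_distribs 1 2)
  finally show ?thesis by (simp only: rmatrix_legs mult.assoc)
qed

text \<open>The condition \<open>c * d = 1\<close> makes \<open>a * b\<close> commute with
  \<open>e0 * f1\<close>. It is meant for products of the Cartan generators, which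
  \<open>K + L\<close> alone does not cover.\<close>

lemma rmatrix_weight_zero:
  assumes "a * e0 = c \<odot> (e0 * a)" "b * f1 = d \<odot> (f1 * b)" "c * d = 1" "a * k0 = k0 * a" "b * k1 = k1 * b"
    and "a * f1 = f1 * a" "a * k1 = k1 * a" "b * e0 = e0 * b" "b * k0 = k0 * b"
  shows "a * b * rmatrix e0 k0 f1 k1 = rmatrix e0 k0 f1 k1 * (a * b)"
proof -
  have 1: "a * cartan k0 k1 = cartan k0 k1 * a" "b * cartan k0 k1 = cartan k0 k1 * b"
    using assms by (auto intro!: cartan_commute)
  have "a * (b * (e0 * f1)) = (c * d) \<odot> (e0 * (f1 * (a * b)))"
    by (simp only: commute_left[OF assms(8)] assms(2) smult_simps qcomm_left[OF assms(1)]
        commute_left[OF assms(6)] mult.commute)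
  then have "e0 * f1 * (a * b) = a * b * (e0 * f1)"
    using assms(3) by (simp add: mult.assoc)
  then have "qexp (e0 * f1) * (a * b) = a * b * qexp (e0 * f1)"
    by (rule qexp_intertwine)
  then show ?thesis
    by (simp only: rmatrix_legs mult.assoc commute_left[OF 1(1)] commute_left[OF 1(2)])
qed

text \<open>Since \<open>qexp 0 = 1\<close>, the term \<open>rmatrix 0 l0 0 k1\<close> is just
  \<open>cartan l0 k1\<close>, inverse to \<open>cartan k0 k1\<close> by multiplicativity.\<close>

lemma rmatrix_inverse:
  defines "S \<equiv> (\<Sum>i<n. (1 - qexp (e0 * f1)) ^ i) * rmatrix 0 l0 0 k1"
  shows "rmatrix e0 k0 f1 k1 * S = 1" "S * rmatrix e0 k0 f1 k1 = 1"
proof -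
  have nil: "(e0 * f1) ^ n = 0"
    by (subst power_mult_commuting) (simp_all add: leg_torsion comm01_rules)
  have "qexp 0 = 1"
    using n_gt_1 by (simp add: qexp_def power_0_left if_distrib[of "\<lambda>x. _ \<odot> x"] sum.If_cases coef_0 cong: if_cong)
  then have r: "rmatrix 0 l0 0 k1 = cartan l0 k1"
    by (subst rmatrix_eq) simp_all
  have l: "cartan k0 k1 * cartan l0 k1 = 1"
    by (subst cartan_mult) (simp_all add: comm01_rules leg_torsion cartan_one_left)
  have r': "cartan l0 k1 * cartan k0 k1 = 1"
    by (subst cartan_mult) (simp_all add: comm01_rules leg_torsion cartan_one_left)
  let ?Q = "qexp (e0 * f1)" and ?P = "\<Sum>i<n. (1 - qexp (e0 * f1)) ^ i"
  have "cartan k0 k1 * (?Q * ?P) * cartan l0 k1 = 1" "?P * (cartan l0 k1 * cartan k0 k1) * ?Q = 1"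
    by (simp_all add: qexp_inverse[OF nil] l r')
  then show "rmatrix e0 k0 f1 k1 * S = 1" "S * rmatrix e0 k0 f1 k1 = 1"
    by (simp_all only: S_def r rmatrix_legs mult.assoc)
qed

section \<open>Three commuting legs: the coproduct identities\<close>

context
  fixes e2 f2 k2 l2 :: 'a
  assumes leg2: "leg e2 f2 k2 l2"
    and comm02: "commuting {e0, f0, k0, l0} {e2, f2, k2, l2}"
    and comm12: "commuting {e1, f1, k1, l1} {e2, f2, k2, l2}"
begin

lemma leg2_facts:
  "k2 * e2 = p \<odot> (e2 * k2)" "k2 * f2 = u \<odot> (f2 * k2)" "k2 ^ n = 1" "e2 ^ n = 0" "f2 ^ n = 0"
  using leg2 by (auto simp: leg_def)

lemma comm2_rules:
  "f2 * e0 = e0 * f2" "f2 * k0 = k0 * f2" "f2 * l0 = l0 * f2"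
  "k2 * e0 = e0 * k2" "k2 * k0 = k0 * k2" "k2 * l0 = l0 * k2"
  "f2 * e1 = e1 * f2" "f2 * f1 = f1 * f2" "f2 * k1 = k1 * f2" "f2 * l1 = l1 * f2"
  "k2 * e1 = e1 * k2" "k2 * f1 = f1 * k2" "k2 * k1 = k1 * k2" "k2 * l1 = l1 * k2"
  using comm02 comm12 by (simp_all add: commuting_def)

text \<open>Oriented rules that sort a word by legs, lower legs to the left;
  \<open>qcomm_rules\<close> then move \<open>k\<close> and \<open>l\<close> to the right within a
  leg.\<close>

lemmas comm_rules = comm01_rules comm2_rules comm01_rules[THEN commute_left] comm2_rules[THEN commute_left]

lemmas qcomm_rules = leg_qcomm leg2_facts(1,2) leg_qcomm[THEN qcomm_left] leg2_facts(1,2)[THEN qcomm_left]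

text \<open>Both factors split multiplicatively. Moving \<open>cartan k1 k2\<close> past the first
  q-exponential then absorbs the \<open>k1\<close> in its argument.\<close>

lemma rmatrix_coproduct_left:
  "rmatrix (e1 + e0 * k1) (k0 * k1) f2 k2 = rmatrix e0 k0 f2 k2 * rmatrix e1 k1 f2 k2"
proof -
  let ?x = "e0 * k1 * f2" and ?y = "e1 * f2"
  have "rmatrix (e1 + e0 * k1) (k0 * k1) f2 k2 = cartan (k0 * k1) k2 * qexp ((e1 + e0 * k1) * f2)"
    by (rule rmatrix_eq)
      (simp_all add: ring_distribs mult.assoc comm_rules qcomm_rules smult_simps smult_add_right)
  \<comment> \<open>The summands change order because \<open>qexp_add\<close> expects first the one
    containing \<open>k1\<close>, which passes \<open>e1\<close> with the scalar
    \<open>p\<close>.\<close>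
  also have "(e1 + e0 * k1) * f2 = ?x + ?y"
    by (simp add: ring_distribs)
  also have "qexp (?x + ?y) = qexp ?x * qexp ?y"
  proof (rule qexp_add)
    show "?x * ?y = p \<odot> (?y * ?x)"
      by (simp add: mult.assoc comm_rules qcomm_rules smult_simps)
    fix r s assume "n \<le> r + s"
    \<comment> \<open>Each of \<open>?x\<close> and \<open>?y\<close> contains one factor
      \<open>f2\<close>, so the product of the powers contains \<open>f2 ^ (r + s)\<close>.\<close>
    then have z: "f2 ^ (r + s) = 0"
      using leg2_facts by (metis le_Suc_ex mult_zero_left power_add)
    have "f2 ^ r * e1 ^ s = e1 ^ s * f2 ^ r"
      by (metis comm2_rules(7) power_commuting_commutes)
    then have "?x ^ r * ?y ^ s = (e0 * k1) ^ r * e1 ^ s * f2 ^ (r + s)"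
      by (subst (1 2) power_mult_commuting)
        (simp_all add: comm_rules mult.assoc power_add commute_left)
    then show "?x ^ r * ?y ^ s = 0" by (simp add: z)
  qed
  also have "cartan (k0 * k1) k2 = cartan k0 k2 * cartan k1 k2"
    by (rule cartan_mult[symmetric]) (simp_all add: comm_rules leg2_facts)
  also have "cartan k0 k2 * cartan k1 k2 * (qexp ?x * qexp ?y)
      = cartan k0 k2 * (cartan k1 k2 * qexp ?x) * qexp ?y"
    by (simp only: mult.assoc)
  also have "cartan k1 k2 * qexp ?x = qexp (e0 * f2) * cartan k1 k2"
  proof (rule qexp_intertwine[symmetric])
    have "cartan k1 k2 = cartan k2 k1" by (rule cartan_sym) (simp add: comm_rules)
    moreover have "cartan k2 k1 * f2 * k1 = f2 * cartan k2 k1"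
      by (rule cartan_lower) (simp_all add: comm_rules qcomm_rules leg_torsion)
    moreover have "e0 * cartan k1 k2 = cartan k1 k2 * e0"
      by (rule cartan_commute) (simp_all add: comm_rules)
    ultimately show "e0 * f2 * cartan k1 k2 = cartan k1 k2 * ?x"
      by (metis mult.assoc comm2_rules(9))
  qed
  finally have "rmatrix (e1 + e0 * k1) (k0 * k1) f2 k2
      = (cartan k0 k2 * qexp (e0 * f2)) * (cartan k1 k2 * qexp (e1 * f2))"
    by (simp only: mult.assoc)
  moreover have "rmatrix e0 k0 f2 k2 = cartan k0 k2 * qexp (e0 * f2)"
    by (rule rmatrix_eq) (simp_all add: comm_rules qcomm_rules)
  moreover have "rmatrix e1 k1 f2 k2 = cartan k1 k2 * qexp (e1 * f2)"
    by (rule rmatrix_eq) (simp_all add: comm_rules qcomm_rules)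
  ultimately show ?thesis by simp
qed

text \<open>The mirror argument: the common nilpotent factor is \<open>e0\<close>, and
  \<open>l1\<close> is absorbed. The summand with \<open>l1 * f2\<close> must come first, which puts
  the legs 0 and 2 in front.\<close>

lemma rmatrix_coproduct_right:
  "rmatrix e0 k0 (f1 + l1 * f2) (k1 * k2) = rmatrix e0 k0 f2 k2 * rmatrix e0 k0 f1 k1"
proof -
  let ?x = "e0 * (l1 * f2)" and ?y = "e0 * f1"
  have "rmatrix e0 k0 (f1 + l1 * f2) (k1 * k2) = cartan k0 (k1 * k2) * qexp (e0 * (f1 + l1 * f2))"
    by (rule rmatrix_eq)
      (simp_all add: ring_distribs mult.assoc comm_rules qcomm_rules smult_simps smult_add_right)
  also have "e0 * (f1 + l1 * f2) = ?x + ?y"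
    by (simp add: ring_distribs)
  also have "qexp (?x + ?y) = qexp ?x * qexp ?y"
  proof (rule qexp_add)
    show "?x * ?y = p \<odot> (?y * ?x)"
      by (simp add: mult.assoc comm_rules qcomm_rules smult_simps)
    fix r s assume "n \<le> r + s"
    then have z: "e0 ^ (r + s) = 0"
      using leg_torsion by (metis le_Suc_ex mult_zero_left power_add)
    have "(l1 * f2) * e0 = e0 * (l1 * f2)" by (simp add: mult.assoc comm_rules)
    then have "(l1 * f2) ^ r * e0 ^ s = e0 ^ s * (l1 * f2) ^ r"
      by (metis power_commuting_commutes)
    then have "?x ^ r * ?y ^ s = e0 ^ (r + s) * (l1 * f2) ^ r * f1 ^ s"
      by (subst (1 2) power_mult_commuting)
        (simp_all add: comm_rules mult.assoc power_add commute_left)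
    then show "?x ^ r * ?y ^ s = 0" by (simp add: z)
  qed
  also have "cartan k0 (k1 * k2) = cartan k0 k2 * cartan k0 k1"
  proof -
    have "cartan k2 k0 * cartan k1 k0 = cartan (k2 * k1) k0"
      by (rule cartan_mult) (simp_all add: comm_rules leg_torsion)
    then show ?thesis
      using cartan_sym[of k2 k0] cartan_sym[of k1 k0] cartan_sym[of "k1 * k2" k0]
      by (simp add: comm_rules mult.assoc)
  qed
  also have "cartan k0 k2 * cartan k0 k1 * (qexp ?x * qexp ?y)
      = cartan k0 k2 * (cartan k0 k1 * qexp ?x) * qexp ?y"
    by (simp only: mult.assoc)
  also have "cartan k0 k1 * qexp ?x = qexp (e0 * f2) * cartan k0 k1"
  proof (rule qexp_intertwine[symmetric])
    have "cartan k0 k1 * e0 = e0 * k1 * cartan k0 k1"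
      by (rule cartan_raise) (simp_all add: comm_rules qcomm_rules leg_torsion)
    moreover have "l1 * cartan k0 k1 = cartan k0 k1 * l1"
      by (rule cartan_commute) (simp_all add: comm_rules)
    ultimately have "cartan k0 k1 * (e0 * l1) = e0 * cartan k0 k1"
      by (metis mult.assoc leg_inverse(5) mult_1_right)
    moreover have "f2 * cartan k0 k1 = cartan k0 k1 * f2"
      by (rule cartan_commute) (simp_all add: comm_rules)
    ultimately show "e0 * f2 * cartan k0 k1 = cartan k0 k1 * ?x"
      by (metis mult.assoc)
  qed
  finally have "rmatrix e0 k0 (f1 + l1 * f2) (k1 * k2)
      = (cartan k0 k2 * qexp (e0 * f2)) * (cartan k0 k1 * qexp (e0 * f1))"
    by (simp only: mult.assoc)
  moreover have "rmatrix e0 k0 f2 k2 = cartan k0 k2 * qexp (e0 * f2)"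
    by (rule rmatrix_eq) (simp_all add: comm_rules qcomm_rules)
  ultimately show ?thesis by (simp only: rmatrix_legs)
qed

end
end
end

subsection \<open>Passing to the presented algebras\<close>

lemma power_add_orthogonal:
  fixes a b :: "'a::semiring_1"
  assumes "a * b = 0" "b * a = 0"
  shows "(a + b) ^ Suc m = a ^ Suc m + b ^ Suc m"
proof (induction m)
  case (Suc m)
  have "a * b ^ Suc m = 0" "b * a ^ Suc m = 0"
    using assms by (simp_all flip: mult.assoc)
  with Suc show ?case
    by (simp only: power_Suc[of "a + b" "Suc m"]) (simp add: algebra_simps)
qed simp

text \<open>\<open>a * b\<close> and \<open>c * d\<close> add up to \<open>1\<close>;
  \<open>x\<close> absorbs the first on its right and \<open>y\<close> the second on its left, so
  \<open>a * b * y = 0\<close>.\<close>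

lemma mutual_inverse_orthogonal:
  fixes a b c d :: "'a::ring_1"
  assumes "a * b * a = a" "b * a * b = b" "a * b = b * a"
    and "c * d * c = c" "d * c * d = d" "c * d = d * c" "a * b + c * d = 1"
    and "x \<in> {a, b}" "y \<in> {c, d}"
  shows "x * y = 0"
proof -
  have "a = a * (a * b)" "b = b * (a * b)" "c = c * d * c" "d = c * d * d"
    using assms(1-6) by (metis mult.assoc)+
  then have x: "x = x * (a * b)" and y: "y = c * d * y"
    using assms(8,9) by auto
  have "a * b * y = (a * b + c * d) * y - c * d * y"
    by (simp add: ring_distribs)
  also have "\<dots> = 0"
    using assms(7) y by simp
  finally have "x * (a * b) * y = 0"
    by (simp add: mult.assoc)
  then show ?thesis using x by simp
qed

context root_scalars
begin

context
  fixes w :: "gen \<Rightarrow> 'a"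
  assumes w_rels: "\<And>a b. (a, b) \<in> Urels n q \<Longrightarrow> ev \<sigma> w a = ev \<sigma> w b"
begin

lemma U_relations:
  "w GK * w GKb * w GK = w GK" "w GKb * w GK * w GKb = w GKb" "w GK * w GKb = w GKb * w GK"
  "w GL * w GLb * w GL = w GL" "w GLb * w GL * w GLb = w GLb" "w GL * w GLb = w GLb * w GL"
  "w GK * w GKb + w GL * w GLb = 1"
  "w GK * w GE = p \<odot> (w GE * w GK)" "w GL * w GE = p \<odot> (w GE * w GL)"
  "w GKb * w GE = u \<odot> (w GE * w GKb)" "w GLb * w GE = u \<odot> (w GE * w GLb)"
  "w GK * w GF = u \<odot> (w GF * w GK)" "w GL * w GF = u \<odot> (w GF * w GL)"
  "w GKb * w GF = p \<odot> (w GF * w GKb)" "w GLb * w GF = p \<odot> (w GF * w GLb)"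
  "w GE * w GF - w GF * w GE = \<delta> \<odot> ((w GK + w GL) - (w GKb + w GLb))"
  "w GK ^ n + w GL ^ n = 1" "w GE ^ n = 0" "w GF ^ n = 0"
proof -
  have "\<forall>(a, b)\<in>Urels n q. ev \<sigma> w a = ev \<sigma> w b"
    using w_rels by auto
  then show
    "w GK * w GKb * w GK = w GK" "w GKb * w GK * w GKb = w GKb" "w GK * w GKb = w GKb * w GK"
    "w GL * w GLb * w GL = w GL" "w GLb * w GL * w GLb = w GLb" "w GL * w GLb = w GLb * w GL"
    "w GK * w GKb + w GL * w GLb = 1"
    "w GK * w GE = p \<odot> (w GE * w GK)" "w GL * w GE = p \<odot> (w GE * w GL)"
    "w GKb * w GE = u \<odot> (w GE * w GKb)" "w GLb * w GE = u \<odot> (w GE * w GLb)"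
    "w GK * w GF = u \<odot> (w GF * w GK)" "w GL * w GF = u \<odot> (w GF * w GL)"
    "w GKb * w GF = p \<odot> (w GF * w GKb)" "w GLb * w GF = p \<odot> (w GF * w GLb)"
    "w GE * w GF - w GF * w GE = \<delta> \<odot> ((w GK + w GL) - (w GKb + w GLb))"
    "w GK ^ n + w GL ^ n = 1" "w GE ^ n = 0" "w GF ^ n = 0"
    unfolding Urels_def Let_def smult_def p_def u_def \<delta>_def ball_simps prod.case ev.simps ev_simps
      ev_power mult.assoc right_minus_eq
    by - (elim conjE, assumption)+
qed

lemma U_orthogonal:
  assumes "x \<in> {w GK, w GKb}" "y \<in> {w GL, w GLb}"
  shows "x * y = 0" "y * x = 0"
proof -
  show "x * y = 0"
    by (rule mutual_inverse_orthogonal[OF U_relations(1-7) assms])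
  have "w GL * w GLb + w GK * w GKb = 1"
    using U_relations(7) by (simp add: add.commute)
  then show "y * x = 0"
    by (rule mutual_inverse_orthogonal[OF U_relations(4-6,1-3) _ assms(2,1)])
qed

lemma U_commute:
  assumes "x \<in> {w GK, w GKb, w GL, w GLb}"
  shows "x * (w GK + w GL) = (w GK + w GL) * x"
  using assms by (auto simp: ring_distribs U_orthogonal U_relations(3,6))

text \<open>All cross terms vanish by orthogonality, so the two sums are mutually inverse and the
  \<open>n\<close>-th power of \<open>K + L\<close> is \<open>K ^ n + L ^ n\<close>.\<close>

lemma U_leg: "leg (w GE) (w GF) (w GK + w GL) (w GKb + w GLb)"
proof -
  have "(w GK + w GL) * (w GKb + w GLb) = 1" "(w GKb + w GLb) * (w GK + w GL) = 1"
    using U_relations(7) by (simp_all add: ring_distribs U_orthogonal flip: U_relations(3,6))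
  moreover have "(w GK + w GL) ^ n = 1"
    using power_add_orthogonal[of "w GK" "w GL" "n - 1"] n_gt_1 U_relations(17)
    by (simp add: U_orthogonal)
  ultimately show ?thesis
    unfolding leg_def U_relations(16)
    by (intro conjI)
      (simp_all only: U_relations semiring_class.distrib_left semiring_class.distrib_right smult_add_right)
qed

end

lemma ev_Rhat:
  "ev \<sigma> v (Rhat n q) = rmatrix (v (0, GE)) (v (0, GK) + v (0, GL)) (v (1, GF)) (v (1, GK) + v (1, GL))"
proof -
  have "sum_list (concat xss) = (\<Sum>xs\<leftarrow>xss. sum_list xs)" for xss :: "'a list list"
    by (induction xss) auto
  then show ?thesis
    by (simp add: Rhat_def rmatrix_def ev_tsum map_concat comp_def interv_sum_list_conv_sum_set_nat
        atLeast0LessThan smult_def mult.assoc)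
qed

end

context central_scalars
begin

text \<open>The inverse of the R-matrix is built in the ring, while the theorem asks for a term.
  These closure rules supply one.\<close>

lemma ev_range:
  "0 \<in> range (ev \<sigma> v)" "1 \<in> range (ev \<sigma> v)" "v g \<in> range (ev \<sigma> v)"
  "x \<in> range (ev \<sigma> v) \<Longrightarrow> y \<in> range (ev \<sigma> v) \<Longrightarrow> x + y \<in> range (ev \<sigma> v)"
  "x \<in> range (ev \<sigma> v) \<Longrightarrow> y \<in> range (ev \<sigma> v) \<Longrightarrow> x - y \<in> range (ev \<sigma> v)"
  "x \<in> range (ev \<sigma> v) \<Longrightarrow> y \<in> range (ev \<sigma> v) \<Longrightarrow> x * y \<in> range (ev \<sigma> v)"
  "x \<in> range (ev \<sigma> v) \<Longrightarrow> c \<odot> x \<in> range (ev \<sigma> v)"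
  "x \<in> range (ev \<sigma> v) \<Longrightarrow> x ^ m \<in> range (ev \<sigma> v)"
proof -
  show "0 \<in> range (ev \<sigma> v)" "1 \<in> range (ev \<sigma> v)" by (metis ev_simps(1) rangeI, metis ev_simps(2) rangeI)
  show "v g \<in> range (ev \<sigma> v)" by (metis ev.simps(1) rangeI)
  assume "x \<in> range (ev \<sigma> v)"
  then obtain s where s: "x = ev \<sigma> v s" by auto
  have "c \<odot> x = ev \<sigma> v (Sc c * s)" by (simp add: s smult_def)
  then show "c \<odot> x \<in> range (ev \<sigma> v)" by (simp only: rangeI)
  have "x ^ m = ev \<sigma> v (s ^ m)" by (simp add: s)
  then show "x ^ m \<in> range (ev \<sigma> v)" by (simp only: rangeI)
  assume "y \<in> range (ev \<sigma> v)"
  then obtain t where t: "y = ev \<sigma> v t" by auto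
  have "x + y = ev \<sigma> v (s + t)" "x - y = ev \<sigma> v (s - t)" "x * y = ev \<sigma> v (s * t)"
    by (simp_all add: s t)
  then show "x + y \<in> range (ev \<sigma> v)" "x - y \<in> range (ev \<sigma> v)" "x * y \<in> range (ev \<sigma> v)"
    by (simp_all only: rangeI)
qed

lemma ev_range_sum: "(\<And>x. x \<in> A \<Longrightarrow> f x \<in> range (ev \<sigma> v)) \<Longrightarrow> sum f A \<in> range (ev \<sigma> v)"
  by (induction A rule: infinite_finite_induct) (simp_all only: sum.infinite sum.empty sum.insert ev_range insert_iff simp_thms)

end

lemma tensor_model:
  assumes "odd n" "n > 1" "primitive_root n q"
  obtains \<sigma> and v :: "nat \<times> gen \<Rightarrow> (nat \<times> gen) prod_alg"
  where "root_scalars \<sigma> n q"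
    and "\<And>a b. pres_eq (Trels n q k) a b \<longleftrightarrow> ev \<sigma> v a = ev \<sigma> v b"
    and "\<And>i a b. i < k \<Longrightarrow> (a, b) \<in> Urels n q \<Longrightarrow> ev \<sigma> (\<lambda>g. v (i, g)) a = ev \<sigma> (\<lambda>g. v (i, g)) b"
    and "\<And>i j a b. i \<noteq> j \<Longrightarrow> v (i, a) * v (j, b) = v (j, b) * v (i, a)"
proof -
  interpret cc: central_scalars "\<lambda>c::complex. c" by (rule central_scalars_complex)
  \<comment> \<open>The counit on each of the first \<open>k\<close> legs; generators of higher
    index are zero by the relations.\<close>
  define \<chi> :: "nat \<times> gen \<Rightarrow> complex" where "\<chi> = (\<lambda>(i, g). if i < k \<and> g \<in> {GK, GKb} then 1 else 0)"
  have U: "ev (\<lambda>c. c) \<chi> (map_tm (Pair i) a) = ev (\<lambda>c. c) \<chi> (map_tm (Pair i) b)"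
    if "i < k" "(a, b) \<in> Urels n q" for i a b
    using that assms(2) by (auto simp: Urels_def Let_def ev_map_tm \<chi>_def power_0_left)
  have "ev (\<lambda>c. c) \<chi> a = ev (\<lambda>c. c) \<chi> b" if "(a, b) \<in> Trels n q k" for a b
    using that unfolding Trels_def by (auto simp: U) (auto simp: \<chi>_def)
  then obtain \<sigma> and v :: "nat \<times> gen \<Rightarrow> (nat \<times> gen) prod_alg" where
    cs: "central_scalars \<sigma>" and eq: "\<And>a b. pres_eq (Trels n q k) a b \<longleftrightarrow> ev \<sigma> v a = ev \<sigma> v b"
    by (rule faithful_model[of "Trels n q k" \<chi>]) auto
  interpret central_scalars \<sigma> by (rule cs)
  show ?thesis
  proof (rule that)
    show "root_scalars \<sigma> n q" by unfold_locales (use assms in auto)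
    show "\<And>a b. pres_eq (Trels n q k) a b \<longleftrightarrow> ev \<sigma> v a = ev \<sigma> v b" by (rule eq)
    show "ev \<sigma> (\<lambda>g. v (i, g)) a = ev \<sigma> (\<lambda>g. v (i, g)) b" if "i < k" "(a, b) \<in> Urels n q" for i a b
    proof -
      have "(map_tm (Pair i) a, map_tm (Pair i) b) \<in> Trels n q k"
        using that by (auto simp: Trels_def)
      from eq[THEN iffD1, OF pres_eq.rel[OF this]] show ?thesis by (simp add: ev_map_tm)
    qed
    show "v (i, a) * v (j, b) = v (j, b) * v (i, a)" if "i \<noteq> j" for i j a b
    proof -
      have "(Gen (i, a) * Gen (j, b), Gen (j, b) * Gen (i, a)) \<in> Trels n q k"
        using that by (auto simp: Trels_def)
      from eq[THEN iffD1, OF pres_eq.rel[OF this]] show ?thesis by simp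
    qed
  qed
qed

lemma commuting_legs:
  fixes v :: "nat \<times> gen \<Rightarrow> 'a::ring_1"
  assumes "\<And>i j a b. i \<noteq> j \<Longrightarrow> v (i, a) * v (j, b) = v (j, b) * v (i, a)" "i \<noteq> j"
  shows "commuting {v (i, GE), v (i, GF), v (i, GK) + v (i, GL), v (i, GKb) + v (i, GLb)}
    {v (j, GE), v (j, GF), v (j, GK) + v (j, GL), v (j, GKb) + v (j, GLb)}"
  by (simp add: commuting_def ring_distribs assms(1)[OF assms(2)] add_ac)

section \<open>The R-matrix properties in the presented tensor powers\<close>

lemma intertwining:
  assumes "odd n" "n > 1" "primitive_root n q"
  shows "\<exists>S. eq2 n q (Rhat n q * S) 1 \<and> eq2 n q (S * Rhat n q) 1 \<and>
            (\<forall>b. eq2 n q (Delta_cop b) (Rhat n q * Delta b * S))"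
proof -
  obtain \<sigma> and v :: "nat \<times> gen \<Rightarrow> (nat \<times> gen) prod_alg" where model:
    "root_scalars \<sigma> n q" "\<And>a b. eq2 n q a b \<longleftrightarrow> ev \<sigma> v a = ev \<sigma> v b"
    and rels: "\<And>i a b. i < 2 \<Longrightarrow> (a, b) \<in> Urels n q \<Longrightarrow> ev \<sigma> (\<lambda>g. v (i, g)) a = ev \<sigma> (\<lambda>g. v (i, g)) b"
    and comm: "\<And>i j a b. i \<noteq> j \<Longrightarrow> v (i, a) * v (j, b) = v (j, b) * v (i, a)"
    by (rule tensor_model[OF assms, where k = 2], rule that) blast+
  interpret root_scalars \<sigma> n q by (rule model)
  let ?k = "\<lambda>i. v (i, GK) + v (i, GL)" and ?l = "\<lambda>i. v (i, GKb) + v (i, GLb)"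
  define R where "R = rmatrix (v (0, GE)) (?k 0) (v (1, GF)) (?k 1)"
  have R: "ev \<sigma> v (Rhat n q) = R" by (simp add: R_def ev_Rhat)
  have legs: "leg (v (i, GE)) (v (i, GF)) (?k i) (?l i)" if "i < 2" for i
    using U_leg[OF rels[OF that]] .
  let ?c = "\<lambda>i j. commuting {v (i, GE), v (i, GF), ?k i, ?l i} {v (j, GE), v (j, GF), ?k j, ?l j}"
  have args: "leg (v (0, GE)) (v (0, GF)) (?k 0) (?l 0)" "leg (v (1, GE)) (v (1, GF)) (?k 1) (?l 1)" "?c 0 1"
    using legs[of 0] legs[of 1] commuting_legs[of v 0 1, OF comm] by simp_all
  define S' where "S' = (\<Sum>i<n. (1 - qexp (v (0, GE) * v (1, GF))) ^ i) * rmatrix 0 (?l 0) 0 (?k 1)"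
  have S': "R * S' = 1" "S' * R = 1"
    using rmatrix_inverse[OF args] by (simp_all add: R_def S'_def)
  have "S' \<in> range (ev \<sigma> v)"
    unfolding S'_def qexp_def rmatrix_def by (intro ev_range ev_range_sum)
  then obtain S where S: "S' = ev \<sigma> v S" by auto
  \<comment> \<open>The coproducts of the four Cartan generators are invariant under the flip and
    are sums of such products, so commuting with \<open>R\<close> settles them.\<close>
  have weight: "v (0, x) * v (1, y) * R = R * (v (0, x) * v (1, y))"
    if "x \<in> {GK, GL} \<and> y \<in> {GK, GL} \<or> x \<in> {GKb, GLb} \<and> y \<in> {GKb, GLb}" for x y
  proof -
    note xy = that
    note r = U_relations(8-15)[of "\<lambda>g. v (0, g)", OF rels] U_relations(8-15)[of "\<lambda>g. v (1, g)", OF rels]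
    obtain c d where cd: "c * d = 1" "v (0, x) * v (0, GE) = smult c (v (0, GE) * v (0, x))"
      "v (1, y) * v (1, GF) = smult d (v (1, GF) * v (1, y))"
    proof (cases "x \<in> {GK, GL}")
      case True
      then show ?thesis using xy by (intro that[OF pu(1)]) (auto simp: r simp del: One_nat_def)
    next
      case False
      then show ?thesis using xy by (intro that[OF pu(2)]) (auto simp: r simp del: One_nat_def)
    qed
    show ?thesis unfolding R_def
    proof (rule rmatrix_weight_zero[OF args cd(2,3,1)])
      show "v (0, x) * ?k 0 = ?k 0 * v (0, x)"
        using that by (intro U_commute[of "\<lambda>g. v (0, g)"] rels) auto
      show "v (1, y) * ?k 1 = ?k 1 * v (1, y)"
        using that by (intro U_commute[of "\<lambda>g. v (1, g)"] rels) auto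
    qed (simp_all add: comm ring_distribs)
  qed
  have gens: "ev \<sigma> v (map_tm flip01 (delta_gen g)) * R = R * ev \<sigma> v (delta_gen g)" for g
  proof (cases g)
    case GE
    then show ?thesis
      using rmatrix_E[OF args] by (simp add: R_def ev_map_tm flip01_def)
  next
    case GF
    then show ?thesis
      using rmatrix_F[OF args] by (simp add: R_def ev_map_tm flip01_def)
  qed (simp_all add: ev_map_tm flip01_def comm[of 1 0] ring_distribs weight add_ac del: One_nat_def)
  have twist: "ev \<sigma> v (Delta_cop b) * R = R * ev \<sigma> v (Delta b)" for b
    unfolding Delta_cop_def Delta_def
  proof (induction b)
    case (Mul a b)
    then show ?case by simp (metis mult.assoc)
  qed (simp_all add: gens scalar_central ring_distribs)
  have "ev \<sigma> v (Delta_cop b) = R * ev \<sigma> v (Delta b) * S'" for b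
    by (metis S'(1) mult.assoc mult_1_right twist)
  then show ?thesis
    using S' by (intro exI[of _ S]) (simp add: model R flip: S)
qed

lemma hexagon:
  assumes "odd n" "n > 1" "primitive_root n q"
  shows "eq3 n q (Delta_id (Rhat n q)) (legs 0 2 (Rhat n q) * legs 1 2 (Rhat n q))"
    and "eq3 n q (id_Delta (Rhat n q)) (legs 0 2 (Rhat n q) * legs 0 1 (Rhat n q))"
proof -
  obtain \<sigma> and v :: "nat \<times> gen \<Rightarrow> (nat \<times> gen) prod_alg" where model:
    "root_scalars \<sigma> n q" "\<And>a b. eq3 n q a b \<longleftrightarrow> ev \<sigma> v a = ev \<sigma> v b"
    and rels: "\<And>i a b. i < 3 \<Longrightarrow> (a, b) \<in> Urels n q \<Longrightarrow> ev \<sigma> (\<lambda>g. v (i, g)) a = ev \<sigma> (\<lambda>g. v (i, g)) b"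
    and comm: "\<And>i j a b. i \<noteq> j \<Longrightarrow> v (i, a) * v (j, b) = v (j, b) * v (i, a)"
    by (rule tensor_model[OF assms, where k = 3], rule that) blast+
  interpret root_scalars \<sigma> n q by (rule model)
  let ?k = "\<lambda>i. v (i, GK) + v (i, GL)" and ?l = "\<lambda>i. v (i, GKb) + v (i, GLb)"
  have legs: "leg (v (i, GE)) (v (i, GF)) (?k i) (?l i)" if "i < 3" for i
    using U_leg[OF rels[OF that]] .
  let ?c = "\<lambda>i j. commuting {v (i, GE), v (i, GF), ?k i, ?l i} {v (j, GE), v (j, GF), ?k j, ?l j}"
  have args: "leg (v (0, GE)) (v (0, GF)) (?k 0) (?l 0)" "leg (v (1, GE)) (v (1, GF)) (?k 1) (?l 1)" "?c 0 1"
    "leg (v (2, GE)) (v (2, GF)) (?k 2) (?l 2)" "?c 0 2" "?c 1 2"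
    using legs[of 0] legs[of 1] legs[of 2] commuting_legs[of v 0 1, OF comm]
      commuting_legs[of v 0 2, OF comm] commuting_legs[of v 1 2, OF comm] by simp_all
  \<comment> \<open>\<open>K + L\<close> is group-like: the four terms of its coproduct
    factor.\<close>
  have k: "v (i, GK) * v (j, GK) + (v (i, GL) * v (j, GL) + v (i, GL) * v (j, GK) + v (i, GK) * v (j, GL))
    = ?k i * ?k j" for i j
    by (simp add: ring_distribs add_ac)
  show "eq3 n q (Delta_id (Rhat n q)) (legs 0 2 (Rhat n q) * legs 1 2 (Rhat n q))"
    using rmatrix_coproduct_left[OF args]
    by (simp add: model Delta_id_def legs_def ev_subst ev_map_tm ev_Rhat k)
  show "eq3 n q (id_Delta (Rhat n q)) (legs 0 2 (Rhat n q) * legs 0 1 (Rhat n q))"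
    using rmatrix_coproduct_right[OF args]
    by (simp add: model id_Delta_def legs_def ev_subst ev_map_tm ev_Rhat k numeral_2_eq_2)
qed

theorem mainTheorem13:
  fixes n :: nat and q :: complex
  assumes "odd n" and "n > 1" and "primitive_root n q"
  shows "(\<exists>S. eq2 n q (Rhat n q * S) 1 \<and> eq2 n q (S * Rhat n q) 1 \<and>
            (\<forall>b. eq2 n q (Delta_cop b) (Rhat n q * Delta b * S)))
       \<and> eq3 n q (Delta_id (Rhat n q)) (legs 0 2 (Rhat n q) * legs 1 2 (Rhat n q))
       \<and> eq3 n q (id_Delta (Rhat n q)) (legs 0 2 (Rhat n q) * legs 0 1 (Rhat n q))"
  using intertwining[OF assms] hexagon[OF assms] by blast

end
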